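(* Let $\mathbf t=(t^{(1)},\dots,t^{(h)})\in\mathbb R^h$. The scalar function on $\Phi\cong\Xi=E_r^+$ $$K_{\mathbf t}(\phi):=\left(\frac{\pi_{\mathbf t}(\phi)}{\pi_J(\phi)}\right)^{1/2}=\prod_{i=1}^h\left|\xi_0^{(i)}\right|^{\frac12\left(t^{(i)}+\frac{r-1}{2}d+1\right)}$$ is an eigenfunction of the Laplace--Beltrami operator $\Delta_{\mathrm{LB}}$, with eigenvalue $$\frac{\Delta_{\mathrm{LB}}K_{\mathbf t}}{K_{\mathbf t}}=\sum_{i=1}^h\left(\frac14 k^{(i)}\left(t^{(i)}-t_R^{(i)}\right)^2-\frac{d^2}{16}k^{(i)}\left(r-2r_{(i)}+k^{(i)}\right)^2\right).$$
   Context: Let $d\in\{1,2\}$ and let $r$ be a positive integer. $E_r$ is the real vector space of symmetric real $r\times r$ matrices (if $d=1$) or Hermitian complex $r\times r$ matrices (if $d=2$), and $E_r^+\subset E_r$ is the open cone of positive definite matrices; $\dim E_r=n=r+r(r-1)d/2$. $|x|$ is the determinant, $x^*$ the (conjugate) transpose, and $\Xi=E_r^+$. Partition and parameters. Let $h\ge2$ and let $\mathbf k=(k^{(1)},\dots,k^{(h)})$ be positive integers with $\sum_i k^{(i)}=r$; put $r_{(i)}=k^{(1)}+\dots+k^{(i)}$. For $\xi\in\Xi$ set $\zeta_{(h)}=\xi$ and, for $i=h,h-1,\dots,2$, write $\zeta_{(i)}\in E^+_{r_{(i)}}$ in blocks with respect to $r_{(i)}=r_{(i-1)}+k^{(i)}$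 as $$\zeta_{(i)}=\begin{bmatrix}\xi_{(i-1)}&\xi^{(i)}_{1/2}\\ (\xi^{(i)}_{1/2})^*&\xi^{(i)}_0\end{bmatrix},\qquad \zeta_{(i-1)}:=\xi_{(i-1)}-\xi^{(i)}_{1/2}(\xi^{(i)}_0)^{-1}(\xi^{(i)}_{1/2})^*\in E^+_{r_{(i-1)}}.$$ Put $\phi^{(1)}=\xi^{(1)}_0:=\zeta_{(1)}$ and $\phi^{(i)}=(\xi^{(i)}_{1/2},\xi^{(i)}_0)$ for $i\ge2$. The map $\xi\mapsto\phi=(\phi^{(1)},\dots,\phi^{(h)})$ is a bijection from $\Xi$ onto $\Phi=\Phi^{(1)}\times\dots\times\Phi^{(h)}$ (each $\xi_0^{(i)}$ positive definite, each $\xi^{(i)}_{1/2}$ an arbitrary $r_{(i-1)}\times k^{(i)}$ matrix) with $d\xi=d\phi$ and $|\xi|=\prod_i|\xi_0^{(i)}|$; $\xi$ and $\phi$ are identified. Priors. $\pi_{\mathbf t}(\phi)=\prod_{i=1}^h|\xi_0^{(i)}|^{t^{(i)}}$; the Jeffreys prior is $\pi_J(\phi)=\prod_{i=1}^h|\xi_0^{(i)}|^{-\left(\frac{r-1}{2}d+1\right)}$. Constants: $t_R^{(i)}=-\left(\frac{2r_{(i)}-k^{(i)}-1}{2}d+1\right)$. Laplace--Beltrami operator. The family of Wishart distributions $W_r(\mu,\xi)$, with density $\frac{|x|^{\mu-n/r}}{\Gamma_r(\mu)}|\xi|^\mu e^{-\mathrm{tr}(\xi x)}$ on $E_r^+$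 (where $\Gamma_r(\mu)$ is the normalizing constant, independent of $\xi$), has Fisher information with respect to $\xi$ per unit of $\mu$ (that is, with $\mu=1$) given by the linear operator $H(\xi):w\mapsto\xi^{-1}w\xi^{-1}$ on $E_r$, i.e. the Riemannian metric $(u,w)\mapsto\mathrm{tr}(\xi^{-1}u\,\xi^{-1}w)$ on $\Xi$. $\Delta_{\mathrm{LB}}$ is the Laplace--Beltrami operator of this metric: in coordinates, with $\overline H(\xi)$ the $n\times n$ matrix of the metric and $\nabla$ the column vector of partial derivatives, $\Delta_{\mathrm{LB}}K=|\overline H|^{-1/2}\,\nabla^{T}\left(|\overline H|^{1/2}\,\overline H^{-1}\nabla K\right)$. *)

theory Defs
  imports "HOL-Analysis.Derivative" "Jordan_Normal_Form.Schur_Decomposition"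
    "Jordan_Normal_Form.Gauss_Jordan_Elimination"
begin

text \<open>Both cases d = 1 (real symmetric) and d = 2 (complex Hermitian) are carried by complex
  matrices; for d = 1 all entries, and all test vectors, are required to be real.\<close>

definition scalars :: "nat \<Rightarrow> complex set" where
  "scalars d = (if d = 1 then \<real> else UNIV)"

definition herm_space :: "nat \<Rightarrow> nat \<Rightarrow> complex mat set" where
  "herm_space d r = {A \<in> carrier_mat r r. mat_adjoint A = A \<and> elements_mat A \<subseteq> scalars d}"

definition pd_cone :: "nat \<Rightarrow> nat \<Rightarrow> complex mat set" where
  "pd_cone d r = {A \<in> herm_space d r.
     \<forall>v \<in> carrier_vec r. set\<^sub>v v \<subseteq> scalars d \<longrightarrow> v \<noteq> 0\<^sub>v r \<longrightarrow> Re ((A *\<^sub>v v) \<bullet>c v) > 0}"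

definition herm_dim :: "nat \<Rightarrow> nat \<Rightarrow> nat" where
  "herm_dim d r = r + r * (r - 1) * d div 2"

text \<open>A real basis of the space of symmetric/Hermitian matrices, that is, a system of
  linear coordinates on it.\<close>

definition herm_basis :: "nat \<Rightarrow> nat \<Rightarrow> (nat \<Rightarrow> complex mat) \<Rightarrow> bool" where
  "herm_basis d r b \<longleftrightarrow>
     (\<forall>i < herm_dim d r. b i \<in> herm_space d r) \<and>
     (\<forall>w \<in> herm_space d r. \<exists>!c :: real vec. c \<in> carrier_vec (herm_dim d r) \<and>
        (\<forall>p < r. \<forall>q < r. w $$ (p, q) =
           (\<Sum>i < herm_dim d r. complex_of_real (c $ i) * b i $$ (p, q))))"

definition mat_trace :: "'a :: comm_monoid_add mat \<Rightarrow> 'a" where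
  "mat_trace A = (\<Sum>i < dim_row A. A $$ (i, i))"

text \<open>The matrix inverse; only meaningful for invertible square matrices.\<close>

abbreviation minv :: "'a :: field mat \<Rightarrow> 'a mat" where
  "minv A \<equiv> the (mat_inverse A)"

text \<open>Determinants of Hermitian matrices are real numbers.\<close>

definition rdet :: "complex mat \<Rightarrow> real" where
  "rdet A = Re (det A)"

definition psum :: "(nat \<Rightarrow> nat) \<Rightarrow> nat \<Rightarrow> nat" where
  "psum k i = (\<Sum>j = 1..i. k j)"

definition schur_compl :: "nat \<Rightarrow> complex mat \<Rightarrow> complex mat" where
  "schur_compl m A = (case split_block A m m of
     (A1, A2, A3, A4) \<Rightarrow> A1 - A2 * minv A4 * mat_adjoint A2)"

function zeta :: "(nat \<Rightarrow> nat) \<Rightarrow> nat \<Rightarrow> complex mat \<Rightarrow> nat \<Rightarrow> complex mat" where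
  "zeta k h \<xi> i = (if i < h then schur_compl (psum k i) (zeta k h \<xi> (Suc i)) else \<xi>)"
  by pat_completeness auto
termination by (relation "measure (\<lambda>(k, h, \<xi>, i). h - i)") auto

declare zeta.simps [simp del]

text \<open>The i-th component is the pair of the upper right and the lower right block. For i = 1
  the splitting is at 0, so the first component of the pair has no rows and the second one is
  all of \<open>zeta k h \<xi> 1\<close>.\<close>

definition block_param ::
    "(nat \<Rightarrow> nat) \<Rightarrow> nat \<Rightarrow> complex mat \<Rightarrow> nat \<Rightarrow> complex mat \<times> complex mat" where
  "block_param k h \<xi> i =
     (case split_block (zeta k h \<xi> i) (psum k (i - 1)) (psum k (i - 1)) of
        (A1, A2, A3, A4) \<Rightarrow> (A2, A4))"

definition prior :: "nat \<Rightarrow> (nat \<Rightarrow> real) \<Rightarrow> (nat \<Rightarrow> complex mat \<times> complex mat) \<Rightarrow> real" where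
  "prior h t \<phi> = (\<Prod>i = 1..h. rdet (snd (\<phi> i)) powr t i)"

definition jeffreys_prior ::
    "nat \<Rightarrow> nat \<Rightarrow> nat \<Rightarrow> (nat \<Rightarrow> complex mat \<times> complex mat) \<Rightarrow> real" where
  "jeffreys_prior d r h \<phi> =
     (\<Prod>i = 1..h. rdet (snd (\<phi> i)) powr (- ((real r - 1) / 2 * real d + 1)))"

definition K_fun ::
    "nat \<Rightarrow> nat \<Rightarrow> nat \<Rightarrow> (nat \<Rightarrow> real) \<Rightarrow> (nat \<Rightarrow> complex mat \<times> complex mat) \<Rightarrow> real" where
  "K_fun d r h t \<phi> = sqrt (prior h t \<phi> / jeffreys_prior d r h \<phi>)"

definition t_R :: "nat \<Rightarrow> (nat \<Rightarrow> nat) \<Rightarrow> nat \<Rightarrow> real" where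
  "t_R d k i = - ((2 * real (psum k i) - real (k i) - 1) / 2 * real d + 1)"

text \<open>Operator form of the Fisher information of the Wishart family (unit shape parameter), and
  the corresponding Riemannian metric.\<close>

definition fisher_op :: "complex mat \<Rightarrow> complex mat \<Rightarrow> complex mat" where
  "fisher_op \<xi> w = minv \<xi> * w * minv \<xi>"

definition fisher_metric :: "complex mat \<Rightarrow> complex mat \<Rightarrow> complex mat \<Rightarrow> real" where
  "fisher_metric \<xi> u w = Re (mat_trace (u * fisher_op \<xi> w))"

text \<open>In the linear coordinates given by a basis \<open>b\<close>, the partial derivative with respect to the
  i-th coordinate is the derivative along the line through the point with direction \<open>b i\<close>.\<close>

definition line_fun :: "(complex mat \<Rightarrow> real) \<Rightarrow> complex mat \<Rightarrow> complex mat \<Rightarrow> real \<Rightarrow> real" where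
  "line_fun f \<xi> w s = f (\<xi> + complex_of_real s \<cdot>\<^sub>m w)"

definition partial :: "(nat \<Rightarrow> complex mat) \<Rightarrow> nat \<Rightarrow> (complex mat \<Rightarrow> real) \<Rightarrow> complex mat \<Rightarrow> real" where
  "partial b i f \<xi> = deriv (line_fun f \<xi> (b i)) 0"

definition metric_mat ::
    "(complex mat \<Rightarrow> complex mat \<Rightarrow> complex mat \<Rightarrow> real) \<Rightarrow> nat \<Rightarrow> (nat \<Rightarrow> complex mat) \<Rightarrow>
     complex mat \<Rightarrow> real mat" where
  "metric_mat g n b \<xi> = mat n n (\<lambda>(i, j). g \<xi> (b i) (b j))"

text \<open>The i-th entry of the vector field under the divergence.\<close>

definition LB_flux ::
    "(complex mat \<Rightarrow> complex mat \<Rightarrow> complex mat \<Rightarrow> real) \<Rightarrow> nat \<Rightarrow> (nat \<Rightarrow> complex mat) \<Rightarrow>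
     (complex mat \<Rightarrow> real) \<Rightarrow> nat \<Rightarrow> complex mat \<Rightarrow> real" where
  "LB_flux g n b f i \<xi> =
     sqrt (det (metric_mat g n b \<xi>)) *
     (\<Sum>j < n. minv (metric_mat g n b \<xi>) $$ (i, j) * partial b j f \<xi>)"

definition laplace_beltrami ::
    "(complex mat \<Rightarrow> complex mat \<Rightarrow> complex mat \<Rightarrow> real) \<Rightarrow> nat \<Rightarrow> (nat \<Rightarrow> complex mat) \<Rightarrow>
     (complex mat \<Rightarrow> real) \<Rightarrow> complex mat \<Rightarrow> real" where
  "laplace_beltrami g n b f \<xi> =
     (\<Sum>i < n. partial b i (LB_flux g n b f i) \<xi>) / sqrt (det (metric_mat g n b \<xi>))"

text \<open>Since \<open>deriv\<close> is total, being an eigenfunction explicitly includes the existence of all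
  derivatives that occur in the operator.\<close>

definition LB_defined_on ::
    "complex mat set \<Rightarrow> (complex mat \<Rightarrow> complex mat \<Rightarrow> complex mat \<Rightarrow> real) \<Rightarrow> nat \<Rightarrow>
     (nat \<Rightarrow> complex mat) \<Rightarrow> (complex mat \<Rightarrow> real) \<Rightarrow> bool" where
  "LB_defined_on X g n b f \<longleftrightarrow> (\<forall>\<xi> \<in> X. \<forall>i < n.
     line_fun f \<xi> (b i) differentiable (at 0) \<and>
     line_fun (LB_flux g n b f i) \<xi> (b i) differentiable (at 0))"

definition LB_eigenfunction_on ::
    "complex mat set \<Rightarrow> (complex mat \<Rightarrow> complex mat \<Rightarrow> complex mat \<Rightarrow> real) \<Rightarrow> nat \<Rightarrow>
     (nat \<Rightarrow> complex mat) \<Rightarrow> (complex mat \<Rightarrow> real) \<Rightarrow> real \<Rightarrow> bool" where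
  "LB_eigenfunction_on X g n b f c \<longleftrightarrow>
     LB_defined_on X g n b f \<and> (\<exists>\<xi> \<in> X. f \<xi> \<noteq> 0) \<and>
     (\<forall>\<xi> \<in> X. laplace_beltrami g n b f \<xi> = c * f \<xi>)"

end

theory Submission
  imports Defs
begin

text \<open>Write \<open>T\<^sub>a(\<xi>)\<close> for the trailing block of \<open>\<xi>\<close> that starts at row
\<open>psum k (a - 1)\<close> and \<open>m\<^sub>a\<close> for its size.  Since a Schur complement divides determinants, the
iterated complements satisfy \<open>|\<xi>\<^sub>0(i)| = |T\<^sub>i| / |T\<^sub>i\<^sub>+\<^sub>1|\<close> (\<open>det_block_param\<close>), where the empty block
has determinant 1.  With \<open>s\<^sub>i\<close> the exponent of \<open>|\<xi>\<^sub>0(i)|\<close> in \<open>K\<close> and \<open>s\<^sub>0 = 0\<close>, the function \<open>K\<close> is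
therefore the power function \<open>\<Prod> |T\<^sub>a| ^ e\<^sub>a\<close> of trailing minors, \<open>e\<^sub>a = s\<^sub>a - s\<^sub>a\<^sub>-\<^sub>1\<close>.  The
Laplace--Beltrami operator is applied to such power functions directly, in the coordinates of an
arbitrary basis.

Let \<open>P\<^sub>a(\<xi>)\<close> be the inverse of \<open>T\<^sub>a(\<xi>)\<close>, padded by zeros to size \<open>r\<close>.  Jacobi's formula says that
the derivative of \<open>ln |T\<^sub>a|\<close> in direction \<open>w\<close> is \<open>tr (P\<^sub>a w)\<close>, and the derivative of \<open>P\<^sub>a\<close> is
\<open>- P\<^sub>a w P\<^sub>a\<close>.  The metric is \<open>tr (\<xi>\<^sup>-\<^sup>1 u \<xi>\<^sup>-\<^sup>1 w)\<close>, so the gradient of \<open>ln |T\<^sub>a|\<close> is the matrix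
\<open>\<xi> P\<^sub>a \<xi>\<close>, and the flux is \<open>\<surd>|H| K\<close> times the coordinates of \<open>\<Sum> e\<^sub>a \<xi> P\<^sub>a \<xi>\<close>, where \<open>H\<close> is the Gram
matrix of the metric (\<open>flux_eq\<close>).

Taking the divergence of the flux leaves sums over the basis, each of which is either a pairing of a
gradient with a linear form (\<open>trace_expand\<close>) or the trace of an operator \<open>w \<mapsto> A w B\<close> on the
space of symmetric or Hermitian matrices.  The latter is \<open>tr A tr B\<close> for \<open>d = 2\<close> and
\<open>(tr A tr B + tr (A B\<^sup>T)) / 2\<close> for \<open>d = 1\<close> (\<open>operator_trace\<close>).  The same formula,
inserted into Jacobi's formula for the Gram matrix of the metric, shows that \<open>ln \<surd>|H|\<close> has
derivative \<open>- \<nu> tr (\<xi>\<^sup>-\<^sup>1 w)\<close> with \<open>\<nu> = n / r = 1 + (r - 1) d / 2\<close>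
(\<open>sqrt_metric_has_derivative\<close>).  Finally \<open>\<xi> P\<^sub>a\<close> is a projection of rank \<open>m\<^sub>a\<close>, and these
projections are nested, so \<open>tr (P\<^sub>a \<xi> P\<^sub>c \<xi>) = min m\<^sub>a m\<^sub>c\<close>.  Collecting terms gives
\<open>\<Delta>K / K = \<Sum> e\<^sub>a e\<^sub>c min m\<^sub>a m\<^sub>c + d / 2 \<Sum> e\<^sub>a m\<^sub>a (r - m\<^sub>a)\<close>
(\<open>laplace_beltrami_power_function\<close>).  Two summations by parts rewrite this in terms of \<open>s\<^sub>i\<close> and
\<open>k\<^sub>i = m\<^sub>i - m\<^sub>i\<^sub>+\<^sub>1\<close> as \<open>\<Sum> k\<^sub>i (s\<^sub>i\<^sup>2 - d / 2 s\<^sub>i (r - 2 r\<^sub>(\<^sub>i\<^sub>) + k\<^sub>i))\<close>; completing the square yields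
the stated eigenvalue.\<close>

section \<open>Traces, adjoints and inverses\<close>

lemma adjoint_dim [simp]:
  "dim_row (mat_adjoint A) = dim_col A" "dim_col (mat_adjoint A) = dim_row A"
  by (auto simp: mat_adjoint_def)

lemma adjoint_carrier [simp]: "A \<in> carrier_mat m n \<Longrightarrow> mat_adjoint A \<in> carrier_mat n m"
  by (auto intro!: carrier_matI)

lemma adjoint_index [simp]:
  "i < dim_col A \<Longrightarrow> j < dim_row A \<Longrightarrow> mat_adjoint A $$ (i, j) = conjugate (A $$ (j, i))"
  by (auto simp: mat_adjoint_def mat_of_rows_index)

lemma index_mult_sum:
  assumes "A \<in> carrier_mat m n" "B \<in> carrier_mat n l" "i < m" "j < l"
  shows "(A * B) $$ (i, j) = (\<Sum>k<n. A $$ (i, k) * B $$ (k, j))"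
  using assms by (auto simp: scalar_prod_def atLeast0LessThan)

lemma adjoint_mult:
  fixes A B :: "complex mat"
  assumes "A \<in> carrier_mat m n" "B \<in> carrier_mat n l"
  shows "mat_adjoint (A * B) = mat_adjoint B * mat_adjoint A"
  using assms
  by (intro eq_matI) (auto simp: scalar_prod_def mult.commute)

lemma adjoint_add:
  fixes A B :: "complex mat"
  assumes "A \<in> carrier_mat m n" "B \<in> carrier_mat m n"
  shows "mat_adjoint (A + B) = mat_adjoint A + mat_adjoint B"
  using assms by (intro eq_matI) auto

lemma adjoint_adjoint:
  fixes A :: "complex mat"
  shows "mat_adjoint (mat_adjoint A) = A"
  by (intro eq_matI) auto

lemma adjoint_one: "mat_adjoint (1\<^sub>m n :: complex mat) = 1\<^sub>m n"
  by (intro eq_matI) (auto simp: one_mat_def)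

lemma det_adjoint:
  fixes A :: "complex mat"
  assumes "A \<in> carrier_mat n n"
  shows "det (mat_adjoint A) = cnj (det A)"
proof -
  have "mat_adjoint A = map_mat cnj (transpose_mat A)"
    using assms by (intro eq_matI) auto
  moreover have "det (map_mat cnj (transpose_mat A)) = cnj (det (transpose_mat A))"
    by (rule comm_ring_hom.hom_det, unfold_locales) auto
  ultimately show ?thesis using det_transpose[OF assms] by simp
qed

lemma trace_mult_comm:
  fixes A B :: "'a :: comm_semiring_0 mat"
  assumes "A \<in> carrier_mat m n" "B \<in> carrier_mat n m"
  shows "mat_trace (A * B) = mat_trace (B * A)"
proof -
  have "mat_trace (A * B) = (\<Sum>i<m. \<Sum>k<n. A $$ (i, k) * B $$ (k, i))"
    using assms by (simp add: mat_trace_def index_mult_sum[OF assms] del: index_mult_mat(1))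
  also have "\<dots> = (\<Sum>k<n. \<Sum>i<m. B $$ (k, i) * A $$ (i, k))"
    by (subst sum.swap) (simp add: mult.commute)
  also have "\<dots> = mat_trace (B * A)"
    using assms by (simp add: mat_trace_def index_mult_sum[OF assms(2,1)] del: index_mult_mat(1))
  finally show ?thesis .
qed

lemma trace_transpose:
  assumes "A \<in> carrier_mat n n"
  shows "mat_trace (transpose_mat A) = mat_trace A"
  using assms by (simp add: mat_trace_def)

lemma trace_one: "mat_trace (1\<^sub>m n :: 'a :: semiring_1 mat) = of_nat n"
  by (simp add: mat_trace_def)

text \<open>The adjugate formula for the inverse.  It is total with the right dimensions, so that the inverse of
a curve of matrices is again a curve of matrices of fixed size, and it is a rational function of the
entries, so that differentiability of the entries is inherited.\<close>

definition ainv :: "'a :: field mat \<Rightarrow> 'a mat" where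
  "ainv A = (1 / det A) \<cdot>\<^sub>m adj_mat A"

lemma ainv_carrier [simp]: "A \<in> carrier_mat n n \<Longrightarrow> ainv A \<in> carrier_mat n n"
  by (simp add: ainv_def adj_mat(1))

lemma ainv_inverse:
  assumes A: "A \<in> carrier_mat n n" and "det A \<noteq> 0"
  shows "A * ainv A = 1\<^sub>m n" "ainv A * A = 1\<^sub>m n"
proof -
  have "A * ainv A = (1 / det A) \<cdot>\<^sub>m (det A \<cdot>\<^sub>m 1\<^sub>m n)"
    using mult_smult_distrib[OF A adj_mat(1)[OF A]] adj_mat(2)[OF A] by (simp add: ainv_def)
  then show "A * ainv A = 1\<^sub>m n" using assms(2) by (auto intro!: eq_matI)
  have "ainv A * A = (1 / det A) \<cdot>\<^sub>m (det A \<cdot>\<^sub>m 1\<^sub>m n)"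
    using mult_smult_assoc_mat[OF adj_mat(1)[OF A] A] adj_mat(3)[OF A] by (simp add: ainv_def)
  then show "ainv A * A = 1\<^sub>m n" using assms(2) by (auto intro!: eq_matI)
qed

lemma ainv_unique:
  fixes A :: "'a :: field mat"
  assumes A: "A \<in> carrier_mat n n" and B: "B \<in> carrier_mat n n" and "B * A = 1\<^sub>m n"
  shows "ainv A = B"
proof -
  have "det B * det A = 1"
    using det_mult[OF B A] assms(3) by simp
  then have "det A \<noteq> 0" by auto
  then have "B * (A * ainv A) = B"
    using B ainv_inverse(1)[OF A] by simp
  moreover have "(B * A) * ainv A = B * (A * ainv A)"
    by (rule assoc_mult_mat[OF B A ainv_carrier[OF A]])
  ultimately show ?thesis using assms A by (metis ainv_carrier left_mult_one_mat)
qed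

lemma minv_eq_ainv:
  fixes A :: "'a :: field mat"
  assumes A: "A \<in> carrier_mat n n" and "det A \<noteq> 0"
  shows "minv A = ainv A"
proof (cases "mat_inverse A")
  case None
  then show ?thesis
    using mat_inverse(1)[OF A, of undefined] det_non_zero_imp_unit[OF A assms(2), of undefined]
    by blast
next
  case (Some B)
  then show ?thesis using mat_inverse(2)[OF A Some] ainv_unique[OF A, of B] by simp
qed

lemma transpose_ainv:
  fixes A :: "'a :: field mat"
  assumes A: "A \<in> carrier_mat n n" and "det A \<noteq> 0"
  shows "transpose_mat (ainv A) = ainv (transpose_mat A)"
  using ainv_unique[of "transpose_mat A" n "transpose_mat (ainv A)"] assms
    transpose_mult[OF A ainv_carrier[OF A]] ainv_inverse[OF assms] by simp

lemma adjoint_ainv: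
  fixes A :: "complex mat"
  assumes A: "A \<in> carrier_mat n n" and "det A \<noteq> 0"
  shows "mat_adjoint (ainv A) = ainv (mat_adjoint A)"
  using ainv_unique[of "mat_adjoint A" n "mat_adjoint (ainv A)"] assms
    adjoint_mult[OF A ainv_carrier[OF A]] ainv_inverse[OF assms] by (simp add: adjoint_one)

section \<open>Derivatives of matrix-valued curves\<close>

text \<open>Entrywise derivative at the parameter 0.  All curves here are sampled around a base point, so no other
parameter occurs.\<close>

definition mat_deriv ::
  "nat \<Rightarrow> nat \<Rightarrow> (real \<Rightarrow> 'a :: real_normed_field mat) \<Rightarrow> 'a mat \<Rightarrow> bool" where
  "mat_deriv m n F D \<longleftrightarrow> (\<forall>s. F s \<in> carrier_mat m n) \<and> D \<in> carrier_mat m n \<and>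
     (\<forall>i<m. \<forall>j<n. ((\<lambda>s. F s $$ (i, j)) has_vector_derivative D $$ (i, j)) (at 0))"

lemma mat_deriv_carrier:
  "mat_deriv m n F D \<Longrightarrow> F s \<in> carrier_mat m n" "mat_deriv m n F D \<Longrightarrow> D \<in> carrier_mat m n"
  by (auto simp: mat_deriv_def)

lemma mat_deriv_entry:
  "mat_deriv m n F D \<Longrightarrow> i < m \<Longrightarrow> j < n \<Longrightarrow>
    ((\<lambda>s. F s $$ (i, j)) has_vector_derivative D $$ (i, j)) (at 0)"
  by (auto simp: mat_deriv_def)

lemma mat_deriv_const: "A \<in> carrier_mat m n \<Longrightarrow> mat_deriv m n (\<lambda>s. A) (0\<^sub>m m n)"
  by (auto simp: mat_deriv_def)

lemma mat_deriv_line: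
  assumes "A \<in> carrier_mat m n" "W \<in> carrier_mat m n"
  shows "mat_deriv m n (\<lambda>s. A + complex_of_real s \<cdot>\<^sub>m W) W"
  using assms by (auto simp: mat_deriv_def intro!: derivative_eq_intros)

lemma mat_deriv_mult:
  assumes F: "mat_deriv m n F F'" and G: "mat_deriv n l G G'"
  shows "mat_deriv m l (\<lambda>s. F s * G s) (F' * G 0 + F 0 * G')"
proof -
  note c = mat_deriv_carrier[OF F] mat_deriv_carrier[OF G]
  have "((\<lambda>s. (F s * G s) $$ (i, j)) has_vector_derivative (F' * G 0 + F 0 * G') $$ (i, j)) (at 0)"
    if ij: "i < m" "j < l" for i j
  proof -
    have "((\<lambda>s. \<Sum>k<n. F s $$ (i, k) * G s $$ (k, j)) has_vector_derivative
        (\<Sum>k<n. F 0 $$ (i, k) * G' $$ (k, j) + F' $$ (i, k) * G 0 $$ (k, j))) (at 0)"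
      using ij by (intro has_vector_derivative_sum has_vector_derivative_mult mat_deriv_entry[OF F]
          mat_deriv_entry[OF G]) auto
    moreover have "(F' * G 0 + F 0 * G') $$ (i, j) =
        (\<Sum>k<n. F 0 $$ (i, k) * G' $$ (k, j) + F' $$ (i, k) * G 0 $$ (k, j))"
      using ij c(4) c(2) carrier_matD[OF c(1)[of 0]] carrier_matD[OF c(3)[of 0]]
      by (simp add: sum.distrib scalar_prod_def atLeast0LessThan)
    moreover have "(\<lambda>s. (F s * G s) $$ (i, j)) = (\<lambda>s. \<Sum>k<n. F s $$ (i, k) * G s $$ (k, j))"
      using index_mult_sum[OF c(1) c(3) ij] by simp
    ultimately show ?thesis by simp
  qed
  moreover have "F s * G s \<in> carrier_mat m l" for s using c by (meson mult_carrier_mat)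
  moreover have "F' * G 0 + F 0 * G' \<in> carrier_mat m l"
    using c by (meson mult_carrier_mat add_carrier_mat)
  ultimately show ?thesis by (simp add: mat_deriv_def)
qed

lemma det_has_derivative:
  assumes F: "mat_deriv n n F D"
  shows "((\<lambda>s. det (F s)) has_vector_derivative
     (\<Sum>p | p permutes {0..<n}. signof p * (\<Sum>i<n. D $$ (i, p i) * (\<Prod>j\<in>{..<n} - {i}. F 0 $$ (j, p j)))))
     (at 0)"
proof -
  have *: "((\<lambda>s. \<Prod>i<n. F s $$ (i, p i)) has_vector_derivative
      (\<Sum>i<n. D $$ (i, p i) * (\<Prod>j\<in>{..<n} - {i}. F 0 $$ (j, p j)))) (at 0)"
    if p: "p permutes {0..<n}" for p
  proof -
    have "((\<lambda>s. \<Prod>i<n. F s $$ (i, p i)) has_derivative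
       (\<lambda>y. \<Sum>i<n. (y *\<^sub>R D $$ (i, p i)) * (\<Prod>j\<in>{..<n} - {i}. F 0 $$ (j, p j)))) (at 0)"
      using permutes_in_image[OF p]
      by (intro has_derivative_prod) (auto intro!: mat_deriv_entry[OF F,
          unfolded has_vector_derivative_def])
    then show ?thesis
      by (simp add: has_vector_derivative_def scaleR_sum_right)
  qed
  have "det (F s) = (\<Sum>p | p permutes {0..<n}. signof p * (\<Prod>i<n. F s $$ (i, p i)))" for s
    using det_def'[OF mat_deriv_carrier(1)[OF F]] by (simp add: atLeast0LessThan)
  then show ?thesis
    by (auto intro!: has_vector_derivative_sum has_vector_derivative_mult_right *)
qed

text \<open>In the Leibniz expansion a permutation other than the identity moves at least two indices; when one
row is differentiated, an off-diagonal entry of the identity matrix remains as a factor.\<close>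

lemma det_has_derivative_at_one:
  assumes F: "mat_deriv n n F D" and F0: "F 0 = 1\<^sub>m n"
  shows "((\<lambda>s. det (F s)) has_vector_derivative mat_trace D) (at 0)"
proof -
  have "signof p * (\<Sum>i<n. D $$ (i, p i) * (\<Prod>j\<in>{..<n} - {i}. F 0 $$ (j, p j)))
      = (if p = id then mat_trace D else 0)"
    if p: "p permutes {0..<n}" for p
  proof (cases "p = id")
    case True
    have "(\<Prod>j\<in>{..<n} - {i}. F 0 $$ (j, j)) = 1" for i
      by (rule prod.neutral) (auto simp: F0)
    then show ?thesis using True mat_deriv_carrier(2)[OF F] by (simp add: mat_trace_def)
  next
    case False
    have "(\<Prod>j\<in>{..<n} - {i}. F 0 $$ (j, p j)) = 0" if i: "i < n" for i
    proof -
      obtain j where j: "j < n" "j \<noteq> i" "p j \<noteq> j"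
      proof -
        obtain a where a: "p a \<noteq> a" using False by fastforce
        then have "a < n" using p by (metis atLeast0LessThan lessThan_iff permutes_not_in)
        moreover have "p (p a) \<noteq> p a" using a permutes_inj[OF p] by (metis injD)
        moreover have "p a < n" using \<open>a < n\<close> permutes_in_image[OF p, of a] by simp
        ultimately show thesis using that a by (cases "a = i") auto
      qed
      have "p j < n" using j permutes_in_image[OF p, of j] by simp
      then have "F 0 $$ (j, p j) = 0" using j by (simp add: F0)
      then show ?thesis using j by (intro prod_zero) auto
    qed
    then show ?thesis using False by (simp del: prod_zero_iff)
  qed
  then have "(\<Sum>p | p permutes {0..<n}. signof p * (\<Sum>i<n. D $$ (i, p i) * (\<Prod>j\<in>{..<n} - {i}. F 0 $$ (j, p j))))
     = (\<Sum>p | p permutes {0..<n}. if p = id then mat_trace D else 0)"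
    by (intro sum.cong) auto
  also have "\<dots> = mat_trace D"
    by (subst sum.delta) (auto simp: finite_permutations permutes_id)
  finally show ?thesis using det_has_derivative[OF F] by simp
qed

text \<open>Jacobi's formula, reduced to the previous lemma by factoring \<open>F 0\<close> out of the determinant.\<close>

lemma det_has_derivative_jacobi:
  assumes F: "mat_deriv n n F D" and F0: "det (F 0) \<noteq> 0"
  shows "((\<lambda>s. det (F s)) has_vector_derivative det (F 0) * mat_trace (ainv (F 0) * D)) (at 0)"
proof -
  let ?Y = "ainv (F 0)"
  note c = mat_deriv_carrier[OF F]
  have Y: "?Y \<in> carrier_mat n n" using c by simp
  have "mat_deriv n n (\<lambda>s. ?Y * F s) (0\<^sub>m n n * F 0 + ?Y * D)"
    by (rule mat_deriv_mult[OF mat_deriv_const[OF Y] F])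
  moreover have "0\<^sub>m n n * F 0 + ?Y * D = ?Y * D"
    using mult_carrier_mat[OF Y c(2)] left_mult_zero_mat[OF c(1)] by simp
  ultimately have "mat_deriv n n (\<lambda>s. ?Y * F s) (?Y * D)" by simp
  then have "((\<lambda>s. det (?Y * F s)) has_vector_derivative mat_trace (?Y * D)) (at 0)"
    by (rule det_has_derivative_at_one) (rule ainv_inverse(2)[OF c(1) F0])
  then have "((\<lambda>s. det (F 0) * det (?Y * F s)) has_vector_derivative
      det (F 0) * mat_trace (?Y * D)) (at 0)"
    by (rule has_vector_derivative_mult_right)
  moreover have "det (F 0) * det (?Y * F s) = det (F s)" for s
  proof -
    have "det (F 0) * det ?Y = 1"
      using det_mult[OF c(1)[of 0] Y] ainv_inverse(1)[OF c(1) F0] det_one by metis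
    then show ?thesis using det_mult[OF Y c(1)[of s]] by (simp add: mult.assoc[symmetric])
  qed
  ultimately show ?thesis by simp
qed

lemma det_eventually_nonzero:
  assumes F: "mat_deriv n n F D" and F0: "det (F 0) \<noteq> 0"
  shows "eventually (\<lambda>s. det (F s) \<noteq> 0) (nhds 0)"
proof -
  have "isCont (\<lambda>s. det (F s)) 0"
    using det_has_derivative[OF F] by (rule has_vector_derivative_continuous)
  then have "((\<lambda>s. det (F s)) \<longlongrightarrow> det (F 0)) (at 0)" by (simp add: isCont_def)
  then have "eventually (\<lambda>s. det (F s) \<noteq> 0) (at 0)"
    using F0 by (rule tendsto_imp_eventually_ne)
  then show ?thesis using F0 by (simp add: eventually_nhds_conv_at)
qed

text \<open>Formulas for derivatives hold only where certain determinants do not vanish, hence only near the base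
point; this transfers derivatives along such local identities.\<close>

lemma has_vector_derivative_cong_ev:
  assumes "eventually (\<lambda>s. f s = g s) (nhds x)" "(f has_vector_derivative D) (at x)"
  shows "(g has_vector_derivative D) (at x)"
  using assms has_derivative_transform_eventually[of f _ x UNIV g]
  unfolding has_vector_derivative_def
  by (auto simp: eventually_nhds_conv_at)

text \<open>The entries are differentiable by the adjugate formula.  The value of the derivative then follows from
differentiating \<open>ainv (F s) * F s = 1\<close>, which holds near \<open>s = 0\<close>.\<close>

lemma mat_deriv_ainv:
  assumes F: "mat_deriv n n F D" and F0: "det (F 0) \<noteq> 0"
  shows "mat_deriv n n (\<lambda>s. ainv (F s)) (- (ainv (F 0) * (D * ainv (F 0))))"
proof -
  let ?Y = "ainv (F 0)"
  note c = mat_deriv_carrier[OF F]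
  have Y: "?Y \<in> carrier_mat n n" using c by simp
  have "\<exists>z. ((\<lambda>s. ainv (F s) $$ (i, j)) has_vector_derivative z) (at 0)"
    if ij: "i < n" "j < n" for i j
  proof -
    let ?M = "\<lambda>A. mat_delete A j i"
    have "mat_deriv (n - 1) (n - 1) (\<lambda>s. ?M (F s)) (?M D)"
      unfolding mat_deriv_def
    proof (intro conjI allI impI)
      show "?M (F s) \<in> carrier_mat (n - 1) (n - 1)" for s using c by (metis mat_delete_carrier)
      show "?M D \<in> carrier_mat (n - 1) (n - 1)" using c by (metis mat_delete_carrier)
      fix k l assume "k < n - 1" "l < n - 1"
      then show "((\<lambda>s. ?M (F s) $$ (k, l)) has_vector_derivative ?M D $$ (k, l)) (at 0)"
        using ij c carrier_matD[OF c(1)] by (auto simp: mat_delete_def intro!: mat_deriv_entry[OF F])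
    qed
    from det_has_derivative[OF this] obtain z1 where
      z1: "((\<lambda>s. det (?M (F s))) has_vector_derivative z1) (at 0)" by blast
    from det_has_derivative[OF F] obtain z2 where
      z2: "((\<lambda>s. det (F s)) has_vector_derivative z2) (at 0)" by blast
    have z3: "((\<lambda>s. inverse (det (F s))) has_derivative
       (\<lambda>h. - (inverse (det (F 0)) * (h *\<^sub>R z2) * inverse (det (F 0))))) (at 0)"
      using Deriv.has_derivative_inverse[OF F0 z2[unfolded has_vector_derivative_def]] by simp
    have z4: "((\<lambda>s. (-1) ^ (j + i) * det (?M (F s))) has_derivative
       (\<lambda>h. h *\<^sub>R ((-1) ^ (j + i) * z1))) (at 0)"
      using has_vector_derivative_mult_right[OF z1] unfolding has_vector_derivative_def by simp
    have eq: "ainv (F s) $$ (i, j) = inverse (det (F s)) * ((-1) ^ (j + i) * det (?M (F s)))" for s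
      using ij c carrier_matD[OF c(1)]
      by (simp add: ainv_def adj_mat_def cofactor_def divide_inverse)
    have "(\<lambda>s. ainv (F s) $$ (i, j)) differentiable (at 0)"
      unfolding eq using has_derivative_mult[OF z3 z4] by (auto simp: differentiable_def)
    then show ?thesis using vector_derivative_works by blast
  qed
  then obtain z where z: "((\<lambda>s. ainv (F s) $$ (i, j)) has_vector_derivative z i j) (at 0)"
    if "i < n" "j < n" for i j by metis
  define E where "E = mat n n (\<lambda>(i, j). z i j)"
  have E: "mat_deriv n n (\<lambda>s. ainv (F s)) E"
    using z c by (auto simp: mat_deriv_def E_def)
  have Ec: "E \<in> carrier_mat n n" by (simp add: E_def)
  have prod: "mat_deriv n n (\<lambda>s. ainv (F s) * F s) (E * F 0 + ?Y * D)"
    by (rule mat_deriv_mult[OF E F])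
  have "(E * F 0 + ?Y * D) $$ (i, j) = 0" if "i < n" "j < n" for i j
  proof -
    have "eventually (\<lambda>s. (ainv (F s) * F s) $$ (i, j) = 1\<^sub>m n $$ (i, j)) (nhds 0)"
      using det_eventually_nonzero[OF F F0] by eventually_elim (simp add: ainv_inverse(2)[OF c(1)])
    from has_vector_derivative_cong_ev[OF this mat_deriv_entry[OF prod that]]
    have "((\<lambda>s. (1\<^sub>m n :: 'a mat) $$ (i, j)) has_vector_derivative (E * F 0 + ?Y * D) $$ (i, j)) (at 0)" .
    moreover have "((\<lambda>s. (1\<^sub>m n :: 'a mat) $$ (i, j)) has_vector_derivative 0) (at 0)" by simp
    ultimately show ?thesis by (rule vector_derivative_unique_at)
  qed
  then have "E * F 0 + ?Y * D = 0\<^sub>m n n" using c(1)[of 0] c(2) Ec carrier_matD[OF Y]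
    by (intro eq_matI) (auto simp del: index_mult_mat(1) index_add_mat(1))
  then have "(E * F 0 + ?Y * D) * ?Y = 0\<^sub>m n n" using Y by simp
  moreover have "(E * F 0 + ?Y * D) * ?Y = E + ?Y * (D * ?Y)"
    using add_mult_distrib_mat[OF mult_carrier_mat[OF Ec c(1)] mult_carrier_mat[OF Y c(2)] Y, of 0]
      assoc_mult_mat[OF Ec c(1) Y, of 0] assoc_mult_mat[OF Y c(2) Y]
      ainv_inverse(1)[OF c(1) F0] right_mult_one_mat[OF Ec] by simp
  ultimately have *: "E + ?Y * (D * ?Y) = 0\<^sub>m n n" by simp
  have "E = - (?Y * (D * ?Y))"
  proof (rule eq_matI)
    fix i j assume "i < dim_row (- (?Y * (D * ?Y)))" "j < dim_col (- (?Y * (D * ?Y)))"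
    then have ij: "i < n" "j < n" using c Y carrier_matD[OF Y] by auto
    have "(E + ?Y * (D * ?Y)) $$ (i, j) = 0" using * ij by simp
    then show "E $$ (i, j) = (- (?Y * (D * ?Y))) $$ (i, j)"
      using ij carrier_matD[OF Y] carrier_matD[OF c(2)] by (simp add: eq_neg_iff_add_eq_0)
  qed (use carrier_matD[OF Y] carrier_matD[OF Ec] carrier_matD[OF c(2)] in auto)
  then show ?thesis using E by simp
qed

section \<open>Symmetric and Hermitian matrices\<close>

text \<open>Realness of the entries in the case \<open>d = 1\<close> is expressed as invariance under transposition, which,
unlike an entrywise condition, passes through products and inverses by pure matrix algebra.\<close>

lemma herm_space_iff:
  assumes "d \<in> {1, 2}"
  shows "A \<in> herm_space d r \<longleftrightarrow>
    A \<in> carrier_mat r r \<and> mat_adjoint A = A \<and> (d = 1 \<longrightarrow> transpose_mat A = A)"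
proof (cases "d = 1")
  case False
  then show ?thesis using assms by (simp add: herm_space_def scalars_def)
next
  case True
  have "elements_mat A \<subseteq> \<real> \<longleftrightarrow> transpose_mat A = A"
    if A: "A \<in> carrier_mat r r" "mat_adjoint A = A"
  proof -
    have adj: "A $$ (i, j) = cnj (A $$ (j, i))" if "i < r" "j < r" for i j
      using adjoint_index[of i A j] A that by auto
    have "elements_mat A \<subseteq> \<real> \<longleftrightarrow> (\<forall>i<r. \<forall>j<r. A $$ (i, j) \<in> \<real>)"
      using A(1) by (blast intro: elements_matI dest: elements_matD)+
    also have "\<dots> \<longleftrightarrow> (\<forall>i<r. \<forall>j<r. A $$ (j, i) = A $$ (i, j))"
      using adj by (metis Reals_cnj_iff)
    also have "\<dots> \<longleftrightarrow> transpose_mat A = A"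
      using A(1) by (auto simp: mat_eq_iff)
    finally show ?thesis .
  qed
  then show ?thesis using True by (auto simp: herm_space_def scalars_def)
qed

context
  fixes d r :: nat
  assumes d: "d \<in> {1, 2}"
begin

lemma herm_carrier: "A \<in> herm_space d r \<Longrightarrow> A \<in> carrier_mat r r"
  by (simp add: herm_space_iff[OF d])

lemma hermD:
  assumes "A \<in> herm_space d r"
  shows "A \<in> carrier_mat r r" "mat_adjoint A = A" "d = 1 \<Longrightarrow> transpose_mat A = A"
  using assms herm_space_iff[OF d] by blast+

lemma hermI:
  assumes "A \<in> carrier_mat r r" "mat_adjoint A = A" "d = 1 \<Longrightarrow> transpose_mat A = A"
  shows "A \<in> herm_space d r"
  using assms herm_space_iff[OF d] by blast

lemma herm_add:
  assumes "A \<in> herm_space d r" "B \<in> herm_space d r"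
  shows "A + B \<in> herm_space d r"
  using hermD[OF assms(1)] hermD[OF assms(2)] adjoint_add[of A r r B] transpose_add[of A r r B]
  by (intro hermI) auto

lemma herm_smult:
  assumes "A \<in> herm_space d r"
  shows "complex_of_real c \<cdot>\<^sub>m A \<in> herm_space d r"
proof -
  have A: "A \<in> carrier_mat r r" "mat_adjoint A = A" "d = 1 \<Longrightarrow> transpose_mat A = A"
    using hermD[OF assms] .
  have "cnj (A $$ (j, i)) = A $$ (i, j)" if "i < r" "j < r" for i j
    using A(1,2) adjoint_index[of i A j] that by auto
  then have "mat_adjoint (complex_of_real c \<cdot>\<^sub>m A) = complex_of_real c \<cdot>\<^sub>m A"
    using A(1) by (intro eq_matI) auto
  moreover have "transpose_mat (complex_of_real c \<cdot>\<^sub>m A) = complex_of_real c \<cdot>\<^sub>m A" if "d = 1"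
  proof -
    have "A $$ (j, i) = A $$ (i, j)" if "i < r" "j < r" for i j
      using A(1) A(3)[OF \<open>d = 1\<close>] that by (metis carrier_matD index_transpose_mat(1))
    then show ?thesis using A(1) by (intro eq_matI) auto
  qed
  ultimately show ?thesis using A(1) by (intro hermI) auto
qed

lemma herm_line:
  assumes "A \<in> herm_space d r" "W \<in> herm_space d r"
  shows "A + complex_of_real s \<cdot>\<^sub>m W \<in> herm_space d r"
  using assms herm_add herm_smult by blast

lemma herm_sandwich:
  assumes "A \<in> herm_space d r" "B \<in> herm_space d r"
  shows "A * (B * A) \<in> herm_space d r"
proof (rule hermI)
  note A = hermD[OF assms(1)] and B = hermD[OF assms(2)]
  note BA = mult_carrier_mat[OF B(1) A(1)]
  show "A * (B * A) \<in> carrier_mat r r" using A(1) BA by (rule mult_carrier_mat)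
  show "mat_adjoint (A * (B * A)) = A * (B * A)"
    using A B by (simp add: adjoint_mult[OF A(1) BA] adjoint_mult[OF B(1) A(1)])
  show "transpose_mat (A * (B * A)) = A * (B * A)" if "d = 1"
    using A B that by (simp add: transpose_mult[OF A(1) BA] transpose_mult[OF B(1) A(1)])
qed

text \<open>The operators \<open>w \<mapsto> A B w + w B A\<close> arise from differentiating the Gram matrix of the metric.\<close>

lemma herm_jordan:
  assumes "A \<in> herm_space d r" "B \<in> herm_space d r" "C \<in> herm_space d r"
  shows "A * (B * C) + C * (B * A) \<in> herm_space d r"
proof (rule hermI)
  note A = hermD[OF assms(1)] and B = hermD[OF assms(2)] and C = hermD[OF assms(3)]
  note BC = mult_carrier_mat[OF B(1) C(1)] and BA = mult_carrier_mat[OF B(1) A(1)]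
  note 1 = mult_carrier_mat[OF A(1) BC] and 2 = mult_carrier_mat[OF C(1) BA]
  show "A * (B * C) + C * (B * A) \<in> carrier_mat r r" using 2 by (rule add_carrier_mat)
  show "mat_adjoint (A * (B * C) + C * (B * A)) = A * (B * C) + C * (B * A)"
    using A(1,2) B(1,2) C(1,2) comm_add_mat[OF 2 1]
    by (simp add: adjoint_add[OF 1 2] adjoint_mult[OF A(1) BC] adjoint_mult[OF B(1) C(1)]
        adjoint_mult[OF C(1) BA] adjoint_mult[OF B(1) A(1)])
  show "transpose_mat (A * (B * C) + C * (B * A)) = A * (B * C) + C * (B * A)" if "d = 1"
    using A(1) B(1) C(1) A(3)[OF that] B(3)[OF that] C(3)[OF that] comm_add_mat[OF 2 1]
    by (simp add: transpose_add[OF 1 2] transpose_mult[OF A(1) BC] transpose_mult[OF B(1) C(1)]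
        transpose_mult[OF C(1) BA] transpose_mult[OF B(1) A(1)])
qed

lemma herm_ainv:
  assumes "A \<in> herm_space d r" "det A \<noteq> 0"
  shows "ainv A \<in> herm_space d r"
  using hermD[OF assms(1)] assms(2) adjoint_ainv[of A r] transpose_ainv[of A r]
  by (intro hermI) auto

lemma det_herm_real:
  assumes "A \<in> herm_space d r"
  shows "det A = complex_of_real (rdet A)"
  using hermD[OF assms] det_adjoint[of A r] by (simp add: rdet_def complex_eq_iff)

end

section \<open>Real coordinates and traces of linear operators\<close>

text \<open>A Kronecker symbol as a function keeps case distinctions out of the double sums over matrix units.\<close>

definition kron :: "nat \<Rightarrow> nat \<Rightarrow> complex" where
  "kron i j = (if i = j then 1 else 0)"

lemma cnj_kron [simp]: "cnj (kron i j) = kron i j"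
  by (simp add: kron_def)

lemma kron_commute: "kron i j = kron j i"
  by (simp add: kron_def)

lemma sum_kron2:
  assumes "k < r" "l < r"
  shows "(\<Sum>p<r. \<Sum>q<r. f p q * (kron k p * kron l q)) = f k l"
proof -
  have one: "(\<Sum>q<r. g q * kron l q) = g l" if "l < r" for g l
  proof -
    have "(\<Sum>q<r. g q * kron l q) = (\<Sum>q<r. if l = q then g q else 0)"
      by (intro sum.cong refl) (simp add: kron_def)
    then show ?thesis using that by simp
  qed
  show ?thesis
    by (simp only: mult.assoc[symmetric] one[OF assms(1)] one[OF assms(2)])
qed

lemma sum_swap3:
  "(\<Sum>i\<in>I. \<Sum>p\<in>P. \<Sum>q\<in>Q. f i p q) = (\<Sum>p\<in>P. \<Sum>q\<in>Q. \<Sum>i\<in>I. f i p q)"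
  by (subst sum.swap) (intro sum.cong refl sum.swap)

lemma mult3_index:
  assumes "A \<in> carrier_mat r r" "X \<in> carrier_mat r r" "B \<in> carrier_mat r r" "p < r" "q < r"
  shows "(A * (X * B)) $$ (p, q) = (\<Sum>k<r. \<Sum>l<r. A $$ (p, k) * (B $$ (l, q) :: 'a :: comm_semiring_0) * X $$ (k, l))"
proof -
  have "(A * (X * B)) $$ (p, q) = (\<Sum>k<r. A $$ (p, k) * (\<Sum>l<r. X $$ (k, l) * B $$ (l, q)))"
    using index_mult_sum[OF assms(1) mult_carrier_mat[OF assms(2,3)] assms(4,5)]
      index_mult_sum[OF assms(2,3) _ assms(5)] by simp
  also have "\<dots> = (\<Sum>k<r. \<Sum>l<r. A $$ (p, k) * B $$ (l, q) * X $$ (k, l))"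
    by (simp add: sum_distrib_left ac_simps)
  finally show ?thesis .
qed

locale herm_coordinates =
  fixes d r n :: nat and b :: "nat \<Rightarrow> complex mat"
  assumes d: "d \<in> {1, 2}" and n: "n = herm_dim d r" and basis: "herm_basis d r b"
begin

lemmas carrierI = herm_carrier[OF d]

lemma b_herm: "i < n \<Longrightarrow> b i \<in> herm_space d r"
  using basis n by (auto simp: herm_basis_def)

lemma b_carrier: "i < n \<Longrightarrow> b i \<in> carrier_mat r r"
  using b_herm carrierI by blast

definition expands :: "complex mat \<Rightarrow> (nat \<Rightarrow> real) \<Rightarrow> bool" where
  "expands w c \<longleftrightarrow> (\<forall>p<r. \<forall>q<r. w $$ (p, q) = (\<Sum>i<n. complex_of_real (c i) * b i $$ (p, q)))"

definition some_coords :: "complex mat \<Rightarrow> nat \<Rightarrow> real" where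
  "some_coords w = (SOME c. expands w c)"

lemma expands_some_coords:
  assumes "w \<in> herm_space d r"
  shows "expands w (some_coords w)"
proof -
  obtain c :: "real vec" where "\<forall>p<r. \<forall>q<r. w $$ (p, q) = (\<Sum>i<n. complex_of_real (c $ i) * b i $$ (p, q))"
    using basis assms unfolding herm_basis_def n by blast
  then have "expands w (\<lambda>i. c $ i)" by (simp add: expands_def)
  then show ?thesis unfolding some_coords_def by (metis someI_ex)
qed

lemma expands_unique:
  assumes w: "w \<in> herm_space d r" and c: "expands w c" and c': "expands w c'" and i: "i < n"
  shows "c i = c' i"
proof -
  have "vec n c = vec n c'"
  proof -
    let ?P = "\<lambda>x. x \<in> carrier_vec (herm_dim d r) \<and>
        (\<forall>p < r. \<forall>q < r. w $$ (p, q) =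
           (\<Sum>i < herm_dim d r. complex_of_real (x $ i) * b i $$ (p, q)))"
    have ex1: "\<exists>!x. ?P x"
      by (rule bspec[OF conjunct2[OF basis[unfolded herm_basis_def]] w])
    have P: "?P (vec n c)" if "expands w c" for c
      using that unfolding expands_def n[symmetric] by simp
    show ?thesis
      by (rule trans[OF sym[OF the1_equality[OF ex1 P[OF c]]] the1_equality[OF ex1 P[OF c']]])
  qed
  then show ?thesis using i by (metis index_vec)
qed

text \<open>The symmetric and the skew part of the matrix unit at \<open>(p, q)\<close>: for \<open>d = 2\<close> that unit is
\<open>sym_unit p q + \<i> skew_unit p q\<close>, and for \<open>d = 1\<close> only the symmetric part lies in the space.\<close>

definition sym_unit :: "nat \<Rightarrow> nat \<Rightarrow> complex mat" where
  "sym_unit p q = mat r r (\<lambda>(k, l). (kron k p * kron l q + kron l p * kron k q) / 2)"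

definition skew_unit :: "nat \<Rightarrow> nat \<Rightarrow> complex mat" where
  "skew_unit p q = mat r r (\<lambda>(k, l).
     if d = 1 then 0 else (kron k p * kron l q - kron l p * kron k q) / (2 * \<i>))"

lemma sym_unit_herm: "sym_unit p q \<in> herm_space d r"
proof (rule hermI[OF d])
  show "sym_unit p q \<in> carrier_mat r r" by (simp add: sym_unit_def)
  show "mat_adjoint (sym_unit p q) = sym_unit p q"
    by (rule eq_matI) (simp_all add: sym_unit_def add.commute)
  show "transpose_mat (sym_unit p q) = sym_unit p q" if "d = 1"
    by (rule eq_matI) (simp_all add: sym_unit_def add.commute)
qed

lemma skew_unit_herm: "skew_unit p q \<in> herm_space d r"
proof (rule hermI[OF d])
  show "skew_unit p q \<in> carrier_mat r r" by (simp add: skew_unit_def)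
  show "mat_adjoint (skew_unit p q) = skew_unit p q"
    by (rule eq_matI) (simp_all add: skew_unit_def right_diff_distrib)
  show "transpose_mat (skew_unit p q) = skew_unit p q" if "d = 1"
    unfolding skew_unit_def using that by (intro eq_matI) simp_all
qed

text \<open>The \<open>i\<close>-th coordinate of a matrix of the space, written as an explicit real-linear function of
the entries.  It makes sense for every \<open>r \<times> r\<close> matrix, so it can be differentiated entrywise and
applied to products that leave the space.\<close>

definition coord :: "nat \<Rightarrow> complex mat \<Rightarrow> real" where
  "coord i w = (\<Sum>p<r. \<Sum>q<r. Re (w $$ (p, q)) * some_coords (sym_unit p q) i
                         - Im (w $$ (p, q)) * some_coords (skew_unit p q) i)"

lemma expand_units:
  assumes w: "w \<in> herm_space d r" and k: "k < r" and l: "l < r"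
  shows "w $$ (k, l) = (\<Sum>p<r. \<Sum>q<r. complex_of_real (Re (w $$ (p, q))) * sym_unit p q $$ (k, l)
                         - complex_of_real (Im (w $$ (p, q))) * skew_unit p q $$ (k, l))"
proof -
  have w': "w \<in> carrier_mat r r" "mat_adjoint w = w" "d = 1 \<Longrightarrow> transpose_mat w = w"
    using hermD[OF d w] .
  have adj: "w $$ (l, k) = cnj (w $$ (k, l))"
    using adjoint_index[of l w k] w' k l by auto
  let ?S = "\<lambda>g :: nat \<Rightarrow> nat \<Rightarrow> complex. (\<Sum>p<r. \<Sum>q<r. g p q)"
  let ?x = "\<lambda>p q. complex_of_real (Re (w $$ (p, q)))" and ?y = "\<lambda>p q. complex_of_real (Im (w $$ (p, q)))"
  \<comment> \<open>The symmetric part of the expansion averages the real parts at (k, l) and (l, k), the skew part takes half the difference of the imaginary parts.\<close>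
  have s1: "?S (\<lambda>p q. ?x p q * sym_unit p q $$ (k, l)) = ?x k l / 2 + ?x l k / 2"
  proof -
    have "?S (\<lambda>p q. ?x p q * sym_unit p q $$ (k, l)) =
      ?S (\<lambda>p q. ?x p q / 2 * (kron k p * kron l q) + ?x p q / 2 * (kron l p * kron k q))"
      using k l by (intro sum.cong refl) (simp add: sym_unit_def field_simps)
    also have "\<dots> = ?x k l / 2 + ?x l k / 2"
      unfolding sum.distrib sum_kron2[OF k l] sum_kron2[OF l k] ..
    finally show ?thesis .
  qed
  have s2: "?S (\<lambda>p q. ?y p q * skew_unit p q $$ (k, l))
      = (if d = 1 then 0 else ?y k l / (2 * \<i>) - ?y l k / (2 * \<i>))"
  proof (cases "d = 1")
    case True
    then show ?thesis unfolding skew_unit_def using k l by simp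
  next
    case False
    have "?S (\<lambda>p q. ?y p q * skew_unit p q $$ (k, l)) =
      ?S (\<lambda>p q. ?y p q / (2 * \<i>) * (kron k p * kron l q) - ?y p q / (2 * \<i>) * (kron l p * kron k q))"
      using k l False by (intro sum.cong refl) (simp add: skew_unit_def field_simps)
    also have "\<dots> = ?y k l / (2 * \<i>) - ?y l k / (2 * \<i>)"
      unfolding sum_subtractf sum_kron2[OF k l] sum_kron2[OF l k] ..
    finally show ?thesis using False by simp
  qed
  have "w $$ (k, l) = ?x k l / 2 + ?x l k / 2 - (if d = 1 then 0 else ?y k l / (2 * \<i>) - ?y l k / (2 * \<i>))"
  proof (cases "d = 1")
    case True
    have "w $$ (l, k) = w $$ (k, l)"
      using w'(1) w'(3)[OF True] k l by (metis carrier_matD index_transpose_mat(1))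
    then have "Im (w $$ (k, l)) = 0" using adj by (simp add: complex_eq_iff)
    then show ?thesis using True adj by (simp add: complex_eq_iff)
  next
    case False
    then show ?thesis using adj by (simp add: complex_eq_iff Re_divide Im_divide power2_eq_square)
  qed
  then show ?thesis by (simp only: s1 s2 sum_subtractf)
qed

text \<open>Both sides are real-linear in \<open>w\<close> and \<open>expand_units\<close> writes \<open>w\<close> in terms of the units, for which
the claim is the definition of their coordinates.\<close>

lemma expands_coord:
  assumes w: "w \<in> herm_space d r"
  shows "expands w (\<lambda>i. coord i w)"
  unfolding expands_def
proof (intro allI impI)
  fix k l assume kl: "k < r" "l < r"
  have e: "(\<Sum>i<n. complex_of_real (some_coords (sym_unit p q) i) * b i $$ (k, l)) = sym_unit p q $$ (k, l)"
    "(\<Sum>i<n. complex_of_real (some_coords (skew_unit p q) i) * b i $$ (k, l)) = skew_unit p q $$ (k, l)"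
    for p q
    using expands_some_coords[OF sym_unit_herm] expands_some_coords[OF skew_unit_herm] kl
    by (auto simp: expands_def)
  have "(\<Sum>i<n. complex_of_real (coord i w) * b i $$ (k, l)) =
     (\<Sum>i<n. \<Sum>p<r. \<Sum>q<r. complex_of_real (Re (w $$ (p, q))) * (complex_of_real (some_coords (sym_unit p q) i) * b i $$ (k, l))
                         - complex_of_real (Im (w $$ (p, q))) * (complex_of_real (some_coords (skew_unit p q) i) * b i $$ (k, l)))"
    by (simp add: coord_def sum_distrib_right left_diff_distrib mult.assoc)
  also have "\<dots> = (\<Sum>p<r. \<Sum>q<r. \<Sum>i<n. complex_of_real (Re (w $$ (p, q))) * (complex_of_real (some_coords (sym_unit p q) i) * b i $$ (k, l))
                         - complex_of_real (Im (w $$ (p, q))) * (complex_of_real (some_coords (skew_unit p q) i) * b i $$ (k, l)))"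
    by (rule sum_swap3)
  also have "\<dots> = w $$ (k, l)"
    by (simp add: sum_subtractf sum_distrib_left[symmetric] e expand_units[OF w kl])
  finally show "w $$ (k, l) = (\<Sum>i<n. complex_of_real (coord i w) * b i $$ (k, l))" by simp
qed

lemma coord_unique:
  assumes "w \<in> herm_space d r" "expands w c" "i < n"
  shows "coord i w = c i"
  using expands_unique[OF assms(1) expands_coord[OF assms(1)] assms(2,3)] .

lemma coord_add:
  assumes "A \<in> carrier_mat r r" "B \<in> carrier_mat r r"
  shows "coord i (A + B) = coord i A + coord i B"
  using assms by (simp add: coord_def sum.distrib[symmetric] algebra_simps)

lemma coord_uminus:
  assumes "A \<in> carrier_mat r r"
  shows "coord i (- A) = - coord i A"
  using assms by (simp add: coord_def sum_negf[symmetric] algebra_simps)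

lemma coord_has_derivative:
  assumes V: "mat_deriv r r V V'"
  shows "((\<lambda>s. coord i (V s)) has_real_derivative coord i V') (at 0)"
proof -
  have "((\<lambda>s. Re (V s $$ (p, q))) has_real_derivative Re (V' $$ (p, q))) (at 0)"
    "((\<lambda>s. Im (V s $$ (p, q))) has_real_derivative Im (V' $$ (p, q))) (at 0)"
    if "p < r" "q < r" for p q
    using mat_deriv_entry[OF V that]
    by (auto simp: has_real_derivative_iff_has_vector_derivative
        intro: bounded_linear.has_vector_derivative[OF bounded_linear_Re]
          bounded_linear.has_vector_derivative[OF bounded_linear_Im])
  then show ?thesis
    unfolding coord_def by (intro DERIV_sum DERIV_diff DERIV_cmult_right) auto
qed

lemma trace_expand:
  assumes w: "w \<in> herm_space d r" and C: "C \<in> carrier_mat r r"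
  shows "Re (mat_trace (C * w)) = (\<Sum>i<n. coord i w * Re (mat_trace (C * b i)))"
proof -
  have wc: "w \<in> carrier_mat r r" using w carrierI by blast
  have tr: "mat_trace (C * X) = (\<Sum>p<r. \<Sum>q<r. C $$ (p, q) * X $$ (q, p))"
    if "X \<in> carrier_mat r r" for X
    using C that by (simp add: mat_trace_def index_mult_sum[of _ r r _ r] del: index_mult_mat(1))
  have "mat_trace (C * w) = (\<Sum>p<r. \<Sum>q<r. \<Sum>i<n. complex_of_real (coord i w) * (C $$ (p, q) * b i $$ (q, p)))"
    unfolding tr[OF wc] using expands_coord[OF w]
    by (intro sum.cong refl) (simp add: expands_def sum_distrib_left mult.left_commute)
  also have "\<dots> = (\<Sum>i<n. complex_of_real (coord i w) * mat_trace (C * b i))"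
  proof -
    have "(\<Sum>p<r. \<Sum>q<r. \<Sum>i<n. complex_of_real (coord i w) * (C $$ (p, q) * b i $$ (q, p)))
      = (\<Sum>i<n. \<Sum>p<r. \<Sum>q<r. complex_of_real (coord i w) * (C $$ (p, q) * b i $$ (q, p)))"
      by (rule sum_swap3[symmetric])
    also have "\<dots> = (\<Sum>i<n. complex_of_real (coord i w) * mat_trace (C * b i))"
      by (intro sum.cong refl) (simp add: tr[OF b_carrier] sum_distrib_left)
    finally show ?thesis .
  qed
  finally show ?thesis by simp
qed

text \<open>The trace of \<open>w \<mapsto> A w B\<close> in an arbitrary basis.  The coordinates of the units recombine with the
basis to the units themselves, so the sum equals the sum over \<open>(p, q)\<close> of the \<open>(p, q)\<close> entries of
the images of the units; there each unit contributes \<open>A\<^sub>p\<^sub>p B\<^sub>q\<^sub>q\<close>, and for \<open>d = 1\<close> half of it together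
with half of the transposed term \<open>A\<^sub>p\<^sub>q B\<^sub>p\<^sub>q\<close>.\<close>

lemma operator_trace:
  assumes A: "A \<in> carrier_mat r r" and B: "B \<in> carrier_mat r r"
  shows "(\<Sum>i<n. coord i (A * (b i * B))) =
    (if d = 1 then (Re (mat_trace A * mat_trace B) + Re (mat_trace (A * transpose_mat B))) / 2
     else Re (mat_trace A * mat_trace B))"
proof -
  let ?E = "\<lambda>X p q. (A * (X * B)) $$ (p, q)"
  have comb: "(\<Sum>i<n. complex_of_real (some_coords H i) * ?E (b i) p q) = ?E H p q"
    if H: "H \<in> herm_space d r" and pq: "p < r" "q < r" for H p q
  proof -
    have "(\<Sum>i<n. complex_of_real (some_coords H i) * ?E (b i) p q)
      = (\<Sum>i<n. \<Sum>k<r. \<Sum>l<r. A $$ (p, k) * B $$ (l, q) * (complex_of_real (some_coords H i) * b i $$ (k, l)))"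
      using pq by (intro sum.cong refl)
        (simp add: mult3_index[OF A b_carrier B] sum_distrib_left mult.left_commute)
    also have "\<dots> = (\<Sum>k<r. \<Sum>l<r. \<Sum>i<n. A $$ (p, k) * B $$ (l, q) * (complex_of_real (some_coords H i) * b i $$ (k, l)))"
      by (rule sum_swap3)
    also have "\<dots> = ?E H p q"
      using expands_some_coords[OF H] pq
      by (simp add: mult3_index[OF A carrierI[OF H] B] sum_distrib_left[symmetric] expands_def)
    finally show ?thesis .
  qed
  have cr: "(\<Sum>i<n. some_coords H i * Re (?E (b i) p q)) = Re (?E H p q)"
    and ci: "(\<Sum>i<n. some_coords H i * Im (?E (b i) p q)) = Im (?E H p q)"
    if "H \<in> herm_space d r" "p < r" "q < r" for H p q
    unfolding comb[OF that, symmetric] by simp_all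
  have "(\<Sum>i<n. coord i (A * (b i * B))) =
     (\<Sum>p<r. \<Sum>q<r. \<Sum>i<n. Re (?E (b i) p q) * some_coords (sym_unit p q) i
                 - Im (?E (b i) p q) * some_coords (skew_unit p q) i)"
    unfolding coord_def by (rule sum_swap3)
  also have "\<dots> = (\<Sum>p<r. \<Sum>q<r. (\<Sum>i<n. some_coords (sym_unit p q) i * Re (?E (b i) p q))
                 - (\<Sum>i<n. some_coords (skew_unit p q) i * Im (?E (b i) p q)))"
    by (simp add: sum_subtractf mult.commute)
  also have "\<dots> = (\<Sum>p<r. \<Sum>q<r. Re (?E (sym_unit p q) p q) - Im (?E (skew_unit p q) p q))"
    by (intro sum.cong refl) (simp add: cr[OF sym_unit_herm] ci[OF skew_unit_herm])
  also have "\<dots> = (\<Sum>p<r. \<Sum>q<r. if d = 1 then Re (A $$ (p, p) * B $$ (q, q) + A $$ (p, q) * B $$ (p, q)) / 2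
       else Re (A $$ (p, p) * B $$ (q, q)))"
  proof (intro sum.cong refl)
    fix p q assume "p \<in> {..<r}" "q \<in> {..<r}"
    then have p: "p < r" and q: "q < r" by auto
    have "?E (sym_unit p q) p q = (\<Sum>k<r. \<Sum>l<r. A $$ (p, k) * B $$ (l, q) / 2 * (kron p k * kron q l)
          + A $$ (p, k) * B $$ (l, q) / 2 * (kron q k * kron p l))"
      unfolding mult3_index[OF A carrierI[OF sym_unit_herm] B p q]
      by (intro sum.cong refl) (simp add: sym_unit_def kron_commute field_simps)
    then have 1: "?E (sym_unit p q) p q = A $$ (p, p) * B $$ (q, q) / 2 + A $$ (p, q) * B $$ (p, q) / 2"
      unfolding sum.distrib sum_kron2[OF p q] sum_kron2[OF q p] .
    have 2: "?E (skew_unit p q) p q = (if d = 1 then 0 else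
        A $$ (p, p) * B $$ (q, q) / (2 * \<i>) - A $$ (p, q) * B $$ (p, q) / (2 * \<i>))"
    proof (cases "d = 1")
      case True
      then show ?thesis
        unfolding mult3_index[OF A carrierI[OF skew_unit_herm] B p q]
        unfolding skew_unit_def by simp
    next
      case False
      have "?E (skew_unit p q) p q = (\<Sum>k<r. \<Sum>l<r. A $$ (p, k) * B $$ (l, q) / (2 * \<i>) * (kron p k * kron q l)
          - A $$ (p, k) * B $$ (l, q) / (2 * \<i>) * (kron q k * kron p l))"
        unfolding mult3_index[OF A carrierI[OF skew_unit_herm] B p q]
        using False by (intro sum.cong refl) (simp add: skew_unit_def kron_commute field_simps)
      then show ?thesis
        unfolding sum_subtractf sum_kron2[OF p q] sum_kron2[OF q p] using False by simp
    qed
    have half: "Re (z / 2) = Re z / 2" "Im (z / (2 * \<i>)) = - Re z / 2" for z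
      by (simp_all add: Im_divide power2_eq_square)
    show "Re (?E (sym_unit p q) p q) - Im (?E (skew_unit p q) p q) =
       (if d = 1 then Re (A $$ (p, p) * B $$ (q, q) + A $$ (p, q) * B $$ (p, q)) / 2
       else Re (A $$ (p, p) * B $$ (q, q)))"
      unfolding 1 2
      by (cases "d = 1") (simp_all only: half if_True if_False plus_complex.sel minus_complex.sel
          zero_complex.sel simp_thms, simp_all add: field_simps)
  qed
  also have "\<dots> = (if d = 1 then (Re (mat_trace A * mat_trace B) + Re (mat_trace (A * transpose_mat B))) / 2
     else Re (mat_trace A * mat_trace B))"
  proof -
    have t1: "mat_trace A * mat_trace B = (\<Sum>p<r. \<Sum>q<r. A $$ (p, p) * B $$ (q, q))"
      using A B by (simp add: mat_trace_def sum_product)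
    have t2: "mat_trace (A * transpose_mat B) = (\<Sum>p<r. \<Sum>q<r. A $$ (p, q) * B $$ (p, q))"
      using A B by (simp add: mat_trace_def index_mult_sum[of _ r r _ r] del: index_mult_mat(1))
    show ?thesis
      unfolding t1 t2
      by (cases "d = 1") (simp_all only: if_True if_False Re_sum plus_complex.sel sum.distrib
          sum_divide_distrib[symmetric] simp_thms)
  qed
  finally show ?thesis .
qed

text \<open>The dimension of the space divided by \<open>r\<close>.\<close>

definition nu :: real where
  "nu = 1 + (real r - 1) * real d / 2"

lemma operator_trace_left:
  assumes A: "A \<in> carrier_mat r r"
  shows "(\<Sum>i<n. coord i (A * b i)) = nu * Re (mat_trace A)"
proof -
  have "(\<Sum>i<n. coord i (A * b i)) = (\<Sum>i<n. coord i (A * (b i * 1\<^sub>m r)))"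
    by (intro sum.cong refl) (simp add: right_mult_one_mat[OF b_carrier])
  then show ?thesis
    using operator_trace[OF A one_carrier_mat] A d
    by (auto simp: trace_one nu_def transpose_one field_simps)
qed

lemma operator_trace_right:
  assumes B: "B \<in> carrier_mat r r"
  shows "(\<Sum>i<n. coord i (b i * B)) = nu * Re (mat_trace B)"
proof -
  have "(\<Sum>i<n. coord i (b i * B)) = (\<Sum>i<n. coord i (1\<^sub>m r * (b i * B)))"
    using B by (intro sum.cong refl arg_cong[where f = "coord _"])
      (metis b_carrier left_mult_one_mat lessThan_iff mult_carrier_mat)
  then show ?thesis
    using operator_trace[OF one_carrier_mat B] B d trace_transpose[OF B]
    by (auto simp: trace_one nu_def field_simps)
qed

end

section \<open>Trailing blocks\<close>

definition trail :: "nat \<Rightarrow> 'a mat \<Rightarrow> 'a mat" where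
  "trail p A = mat (dim_row A - p) (dim_col A - p) (\<lambda>(i, j). A $$ (i + p, j + p))"

text \<open>The inclusion of the last \<open>r - p\<close> coordinates; compressing by it gives the trailing block
(\<open>trail_eq\<close>), which turns block manipulations into associativity of products.\<close>

definition sel :: "nat \<Rightarrow> nat \<Rightarrow> complex mat" where
  "sel r p = mat r (r - p) (\<lambda>(i, j). if i = j + p then 1 else 0)"

text \<open>The inverse of the trailing block, padded by zeros.\<close>

definition trail_inv :: "nat \<Rightarrow> complex mat \<Rightarrow> complex mat" where
  "trail_inv p A = sel (dim_row A) p * (ainv (trail p A) * transpose_mat (sel (dim_row A) p))"

lemma trail_carrier [simp]: "A \<in> carrier_mat r r \<Longrightarrow> trail p A \<in> carrier_mat (r - p) (r - p)"
  by (simp add: trail_def)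

lemma sel_carrier [simp]:
  "sel r p \<in> carrier_mat r (r - p)" "transpose_mat (sel r p) \<in> carrier_mat (r - p) r"
  by (simp_all add: sel_def)

lemma trail_index:
  "A \<in> carrier_mat r r \<Longrightarrow> i < r - p \<Longrightarrow> j < r - p \<Longrightarrow> trail p A $$ (i, j) = A $$ (i + p, j + p)"
  by (simp add: trail_def)

lemma mult_sel_index:
  assumes "A \<in> carrier_mat m r" "i < m" "j < r - p"
  shows "(A * sel r p) $$ (i, j) = A $$ (i, j + p)"
proof -
  have "(A * sel r p) $$ (i, j) = (\<Sum>k<r. A $$ (i, k) * sel r p $$ (k, j))"
    using index_mult_sum[OF assms(1) sel_carrier(1) assms(2,3)] .
  also have "\<dots> = (\<Sum>k<r. if j + p = k then A $$ (i, k) else 0)"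
    using assms by (intro sum.cong refl) (auto simp: sel_def)
  finally show ?thesis using assms by simp
qed

lemma sel_transpose_mult_index:
  assumes "A \<in> carrier_mat r m" "i < r - p" "j < m"
  shows "(transpose_mat (sel r p) * A) $$ (i, j) = A $$ (i + p, j)"
proof -
  have "(transpose_mat (sel r p) * A) $$ (i, j) = (\<Sum>k<r. transpose_mat (sel r p) $$ (i, k) * A $$ (k, j))"
    using index_mult_sum[OF sel_carrier(2) assms(1,2,3)] .
  also have "\<dots> = (\<Sum>k<r. if i + p = k then A $$ (k, j) else 0)"
    using assms by (intro sum.cong refl) (auto simp: sel_def)
  finally show ?thesis using assms by simp
qed

lemma trail_eq:
  assumes A: "A \<in> carrier_mat r r"
  shows "trail p A = transpose_mat (sel r p) * (A * sel r p)"
proof (rule eq_matI)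
  have c: "A * sel r p \<in> carrier_mat r (r - p)" using A by simp
  have c': "transpose_mat (sel r p) * (A * sel r p) \<in> carrier_mat (r - p) (r - p)"
    using sel_carrier(2) c by (rule mult_carrier_mat)
  show "dim_row (trail p A) = dim_row (transpose_mat (sel r p) * (A * sel r p))"
    "dim_col (trail p A) = dim_col (transpose_mat (sel r p) * (A * sel r p))"
    using carrier_matD[OF c'] carrier_matD[OF trail_carrier[OF A]] by simp_all
  fix i j assume "i < dim_row (transpose_mat (sel r p) * (A * sel r p))"
    "j < dim_col (transpose_mat (sel r p) * (A * sel r p))"
  then have ij: "i < r - p" "j < r - p" using carrier_matD[OF c'] by simp_all
  then have "i + p < r" by simp
  then show "trail p A $$ (i, j) = (transpose_mat (sel r p) * (A * sel r p)) $$ (i, j)"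
    using ij by (simp only: trail_index[OF A] sel_transpose_mult_index[OF c] mult_sel_index[OF A])
qed

lemma trail_0: "trail 0 A = A"
  by (rule eq_matI) (simp_all add: trail_def)

lemma sel_sel:
  assumes "p \<le> q"
  shows "sel r q = sel r p * sel (r - p) (q - p)"
proof (rule eq_matI)
  have d: "r - p - (q - p) = r - q" using assms by linarith
  show "dim_row (sel r q) = dim_row (sel r p * sel (r - p) (q - p))"
    "dim_col (sel r q) = dim_col (sel r p * sel (r - p) (q - p))"
    using d by (simp_all add: sel_def)
  fix i j assume "i < dim_row (sel r p * sel (r - p) (q - p))" "j < dim_col (sel r p * sel (r - p) (q - p))"
  then have "i < r" "j < r - q" using d by (simp_all add: sel_def)
  then show "sel r q $$ (i, j) = (sel r p * sel (r - p) (q - p)) $$ (i, j)"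
    using assms mult_sel_index[OF sel_carrier(1), of i r j p "q - p"] d by (auto simp: sel_def)
qed

lemma trail_herm:
  assumes d: "d \<in> {1, 2}" and A: "A \<in> herm_space d r"
  shows "trail p A \<in> herm_space d (r - p)"
proof (rule hermI[OF d])
  note A = hermD[OF d A]
  show "trail p A \<in> carrier_mat (r - p) (r - p)" using A(1) by simp
  have "cnj (A $$ (j, i)) = A $$ (i, j)" if "i < r" "j < r" for i j
    using A(1,2) adjoint_index[of i A j] that by auto
  then show "mat_adjoint (trail p A) = trail p A"
    using A(1) by (intro eq_matI) (simp_all add: trail_def)
  show "transpose_mat (trail p A) = trail p A" if "d = 1"
  proof -
    have "A $$ (j, i) = A $$ (i, j)" if "i < r" "j < r" for i j
      using A(1) A(3)[OF \<open>d = 1\<close>] that by (metis carrier_matD index_transpose_mat(1))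
    then show ?thesis using A(1) by (intro eq_matI) (simp_all add: trail_def)
  qed
qed

lemma assoc_mult_mat4:
  fixes A B C D :: "'a :: semiring_0 mat"
  assumes "A \<in> carrier_mat a b" "B \<in> carrier_mat b c" "C \<in> carrier_mat c d" "D \<in> carrier_mat d e"
  shows "A * (B * (C * D)) = (A * (B * C)) * D"
  using assoc_mult_mat[OF assms(2,3,4)]
    assoc_mult_mat[OF assms(1) mult_carrier_mat[OF assms(2,3)] assms(4)] by simp

context
  fixes r p :: nat and A J Jt T Y P :: "complex mat"
  assumes A: "A \<in> carrier_mat r r" and det: "det (trail p A) \<noteq> 0"
  defines "J \<equiv> sel r p" and "Jt \<equiv> transpose_mat (sel r p)" and "T \<equiv> trail p A" and "Y \<equiv> ainv (trail p A)" and "P \<equiv> trail_inv p A"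
begin

private lemma c: "J \<in> carrier_mat r (r - p)" "Jt \<in> carrier_mat (r - p) r"
  "T \<in> carrier_mat (r - p) (r - p)" "Y \<in> carrier_mat (r - p) (r - p)"
  using A by (simp_all add: J_def Jt_def T_def Y_def)

private lemmas assoc = assoc_mult_mat[OF c(1) mult_carrier_mat[OF c(4,2)]]
  assoc_mult_mat[OF c(4,2)]

private lemma P_eq: "P = J * (Y * Jt)"
  using A by (simp add: P_def trail_inv_def J_def Jt_def Y_def)

private lemma YT: "Y * T = 1\<^sub>m (r - p)"
  using ainv_inverse(2)[OF trail_carrier[OF A] det] by (simp add: Y_def T_def)

private lemma T_eq: "T = Jt * (A * J)"
  unfolding T_def J_def Jt_def by (rule trail_eq[OF A])

lemma trail_inv_carrier: "trail_inv p A \<in> carrier_mat r r"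
  using mult_carrier_mat[OF c(1) mult_carrier_mat[OF c(4,2)]] P_eq unfolding P_def by simp

text \<open>Hence \<open>P * A\<close> is a projection onto the span of the last \<open>r - p\<close> unit vectors.\<close>

lemma trail_inv_mult_sel: "P * (A * J) = J"
proof -
  have "P * (A * J) = J * (Y * T)"
    unfolding P_eq T_eq using mult_carrier_mat[OF A c(1)] by (simp only: assoc)
  then show ?thesis using c(1) YT by simp
qed

lemma trace_trail_inv_mult:
  assumes D: "D \<in> carrier_mat r r"
  shows "mat_trace (trail_inv p A * D) = mat_trace (ainv (trail p A) * (transpose_mat (sel r p) * (D * sel r p)))"
proof -
  have "P * D = J * (Y * (Jt * D))"
    unfolding P_eq by (simp only: assoc[OF D])
  also have "mat_trace (J * (Y * (Jt * D))) = mat_trace ((Y * (Jt * D)) * J)"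
    by (rule trace_mult_comm[OF c(1) mult_carrier_mat[OF c(4) mult_carrier_mat[OF c(2) D]]])
  also have "(Y * (Jt * D)) * J = Y * (Jt * (D * J))"
    by (simp only: assoc_mult_mat[OF c(4) mult_carrier_mat[OF c(2) D] c(1)]
        assoc_mult_mat[OF c(2) D c(1)])
  finally show ?thesis by (simp add: P_def Y_def J_def Jt_def)
qed

lemma trace_trail_inv_self: "mat_trace (trail_inv p A * A) = of_nat (r - p)"
  using trace_trail_inv_mult[OF A] YT T_eq by (simp add: trace_one J_def Jt_def T_def Y_def)

lemma trail_inv_herm:
  assumes d: "d \<in> {1, 2}" and herm: "A \<in> herm_space d r"
  shows "trail_inv p A \<in> herm_space d r"
proof (rule hermI[OF d])
  have Yh: "Y \<in> herm_space d (r - p)"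
    unfolding Y_def by (rule herm_ainv[OF d trail_herm[OF d herm] det])
  note Y = hermD[OF d Yh]
  have Ja: "mat_adjoint J = Jt" "mat_adjoint (Jt) = J"
    by (rule eq_matI; simp add: J_def Jt_def sel_def)+
  have Jt: "transpose_mat J = Jt" "transpose_mat Jt = J" by (simp_all add: J_def Jt_def)
  note YJ = mult_carrier_mat[OF c(4,2)]
  show "trail_inv p A \<in> carrier_mat r r" by (rule trail_inv_carrier)
  have "mat_adjoint P = P" unfolding P_eq
    using assoc_mult_mat[OF c(1) c(4) c(2)] Ja Y(2) by (simp add: adjoint_mult[OF c(1) YJ] adjoint_mult[OF c(4) c(2)])
  then show "mat_adjoint (trail_inv p A) = trail_inv p A" by (simp add: P_def)
  have "transpose_mat P = P" if "d = 1" unfolding P_eq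
    using assoc_mult_mat[OF c(1) c(4) c(2)] Y(3)[OF that] Jt by (simp add: transpose_mult[OF c(1) YJ] transpose_mult[OF c(4) c(2)])
  then show "transpose_mat (trail_inv p A) = trail_inv p A" if "d = 1" using that by (simp add: P_def)
qed

end

text \<open>The range of \<open>trail_inv q A\<close> lies in the range of \<open>sel r p\<close>, on which \<open>trail_inv p A * A\<close> acts as the
identity.\<close>

lemma trail_inv_nested:
  assumes A: "A \<in> carrier_mat r r" and "p \<le> q" and "det (trail p A) \<noteq> 0" "det (trail q A) \<noteq> 0"
  shows "trail_inv p A * (A * trail_inv q A) = trail_inv q A"
proof -
  let ?P = "trail_inv p A" and ?J = "sel r q" and ?N = "sel (r - p) (q - p)"
  define Z where "Z = ainv (trail q A) * transpose_mat ?J"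
  have P: "?P \<in> carrier_mat r r" by (rule trail_inv_carrier[OF A assms(3)])
  have N: "?N \<in> carrier_mat (r - p) (r - q)"
    using sel_carrier(1)[of "r - p" "q - p"] assms(2) by simp
  have Z: "Z \<in> carrier_mat (r - q) r" unfolding Z_def using A by (simp add: mult_carrier_mat[of _ _ "r - q"])
  have Q: "trail_inv q A = ?J * Z" using A by (simp add: trail_inv_def Z_def)
  have Jq: "?J = sel r p * ?N" by (rule sel_sel[OF assms(2)])
  have J: "?P * (A * ?J) = ?J"
  proof -
    have "?P * (A * (sel r p * ?N)) = (?P * (A * sel r p)) * ?N"
      by (rule assoc_mult_mat4[OF P A sel_carrier(1) N])
    then show ?thesis using trail_inv_mult_sel[OF A assms(3)] Jq by simp
  qed
  have "?P * (A * (?J * Z)) = (?P * (A * ?J)) * Z"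
    by (rule assoc_mult_mat4[OF P A sel_carrier(1) Z])
  then show ?thesis using J Q by simp
qed

lemma mat_deriv_const_mult:
  assumes A: "A \<in> carrier_mat m k" and F: "mat_deriv k n F D"
  shows "mat_deriv m n (\<lambda>s. A * F s) (A * D)"
proof -
  have "0\<^sub>m m k * F 0 + A * D = A * D"
    using left_mult_zero_mat[OF mat_deriv_carrier(1)[OF F]]
      mult_carrier_mat[OF A mat_deriv_carrier(2)[OF F]] by simp
  then show ?thesis using mat_deriv_mult[OF mat_deriv_const[OF A] F] by simp
qed

lemma mat_deriv_mult_const:
  assumes A: "A \<in> carrier_mat k n" and F: "mat_deriv m k F D"
  shows "mat_deriv m n (\<lambda>s. F s * A) (D * A)"
proof -
  have "D * A + F 0 * 0\<^sub>m k n = D * A"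
    using right_mult_zero_mat[OF mat_deriv_carrier(1)[OF F]]
      mult_carrier_mat[OF mat_deriv_carrier(2)[OF F] A] by simp
  then show ?thesis using mat_deriv_mult[OF F mat_deriv_const[OF A]] by simp
qed

lemma mat_deriv_trail:
  assumes F: "mat_deriv r r F D"
  shows "mat_deriv (r - p) (r - p) (\<lambda>s. trail p (F s)) (transpose_mat (sel r p) * (D * sel r p))"
  unfolding trail_eq[OF mat_deriv_carrier(1)[OF F]]
  by (intro mat_deriv_const_mult[OF sel_carrier(2)] mat_deriv_mult_const[OF sel_carrier(1)] F)

text \<open>The formula for the derivative of an inverse survives the padding by zeros.\<close>

lemma mat_deriv_trail_inv:
  assumes F: "mat_deriv r r F D" and det: "det (trail p (F 0)) \<noteq> 0"
  shows "mat_deriv r r (\<lambda>s. trail_inv p (F s)) (- (trail_inv p (F 0) * (D * trail_inv p (F 0))))"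
proof -
  let ?J = "sel r p"
  define Y where "Y = ainv (trail p (F 0))"
  note c = mat_deriv_carrier[OF F]
  have Y: "Y \<in> carrier_mat (r - p) (r - p)" using c by (simp add: Y_def)
  have dim: "dim_row (F s) = r" for s using c(1)[of s] by simp
  let ?D = "transpose_mat ?J * (D * ?J)"
  have D1: "?D \<in> carrier_mat (r - p) (r - p)" using mat_deriv_carrier(2)[OF mat_deriv_trail[OF F]] .
  have "mat_deriv (r - p) (r - p) (\<lambda>s. ainv (trail p (F s))) (- (Y * (?D * Y)))"
    unfolding Y_def by (rule mat_deriv_ainv[OF mat_deriv_trail[OF F] det])
  then have "mat_deriv r r (\<lambda>s. trail_inv p (F s)) (?J * (- (Y * (?D * Y)) * transpose_mat ?J))"
    unfolding trail_inv_def dim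
    by (intro mat_deriv_const_mult[OF sel_carrier(1)] mat_deriv_mult_const[OF sel_carrier(2)])
  moreover have "?J * (- (Y * (?D * Y)) * transpose_mat ?J) = - (trail_inv p (F 0) * (D * trail_inv p (F 0)))"
  proof -
    define J where "J = ?J"
    define Jt where "Jt = transpose_mat ?J"
    have J: "J \<in> carrier_mat r (r - p)" "Jt \<in> carrier_mat (r - p) r" by (simp_all add: J_def Jt_def)
    note YJ = mult_carrier_mat[OF Y J(2)]
    note P = mult_carrier_mat[OF J(1) YJ]
    note DP = mult_carrier_mat[OF c(2) P]
    have e: "(Jt * (D * J)) * (Y * Jt) = Jt * (D * (J * (Y * Jt)))"
      by (simp only: assoc_mult_mat[OF J(2) mult_carrier_mat[OF c(2) J(1)] YJ]
          assoc_mult_mat[OF c(2) J(1) YJ])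
    have JDJ: "Jt * (D * J) \<in> carrier_mat (r - p) (r - p)"
      using mult_carrier_mat[OF J(2) mult_carrier_mat[OF c(2) J(1)]] .
    note X = mult_carrier_mat[OF Y mult_carrier_mat[OF JDJ Y]]
    have "J * (- (Y * ((Jt * (D * J)) * Y)) * Jt) = - (J * (Y * ((Jt * (D * J)) * Y) * Jt))"
      using carrier_matD[OF X] carrier_matD[OF J(1)] carrier_matD[OF J(2)]
      by (simp del: assoc_mult_mat)
    also have "J * (Y * ((Jt * (D * J)) * Y) * Jt) = J * (Y * ((Jt * (D * J)) * (Y * Jt)))"
      by (simp only: assoc_mult_mat[OF Y mult_carrier_mat[OF JDJ Y] J(2)]
          assoc_mult_mat[OF JDJ Y J(2)])
    also have "\<dots> = (J * (Y * Jt)) * (D * (J * (Y * Jt)))"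
      unfolding e
      by (simp only: assoc_mult_mat[OF J(1) YJ DP] assoc_mult_mat[OF Y J(2) DP])
    finally show ?thesis by (simp add: trail_inv_def dim J_def Jt_def Y_def)
  qed
  ultimately show ?thesis by simp
qed

text \<open>The real logarithm satisfies \<open>ln x = ln \<bar>x\<bar>\<close>, so the rule for its derivative also holds at
negative arguments and minors may have either sign.\<close>

lemma ln_has_derivative:
  "x \<noteq> 0 \<Longrightarrow> (ln has_real_derivative 1 / x) (at (x :: real))"
proof -
  assume "x \<noteq> 0"
  then consider "x > 0" | "x < 0" by linarith
  then show ?thesis
  proof cases
    case 1
    then show ?thesis by (rule DERIV_ln_divide)
  next
    case 2
    then have "((\<lambda>y. ln (- y)) has_real_derivative 1 / (- x) * (- 1)) (at x)"
      by (intro DERIV_chain2[of ln] DERIV_ln_divide derivative_eq_intros) auto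
    then show ?thesis by (simp add: ln_minus)
  qed
qed

lemma ln_trail_has_derivative:
  assumes d: "d \<in> {1, 2}" and F: "mat_deriv r r F D" and h: "F 0 \<in> herm_space d r"
    and det: "det (trail p (F 0)) \<noteq> 0"
  shows "((\<lambda>s. ln (rdet (trail p (F s)))) has_real_derivative Re (mat_trace (trail_inv p (F 0) * D))) (at 0)"
proof -
  note c = mat_deriv_carrier[OF F]
  have real: "det (trail p (F 0)) = complex_of_real (rdet (trail p (F 0)))"
    by (rule det_herm_real[OF d trail_herm[OF d h]])
  then have nz: "rdet (trail p (F 0)) \<noteq> 0" using det by auto
  have "((\<lambda>s. det (trail p (F s))) has_vector_derivative
      complex_of_real (rdet (trail p (F 0))) * mat_trace (trail_inv p (F 0) * D)) (at 0)"
    using det_has_derivative_jacobi[OF mat_deriv_trail[OF F] det]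
    by (simp add: trace_trail_inv_mult[OF c(1) det c(2)] flip: real)
  then have "((\<lambda>s. rdet (trail p (F s))) has_real_derivative
      rdet (trail p (F 0)) * Re (mat_trace (trail_inv p (F 0) * D))) (at 0)"
    using bounded_linear.has_vector_derivative[OF bounded_linear_Re]
    by (fastforce simp: has_real_derivative_iff_has_vector_derivative rdet_def)
  from DERIV_chain2[where f = ln and g = "\<lambda>s. rdet (trail p (F s))",
      OF ln_has_derivative[OF nz] this]
  show ?thesis using nz by simp
qed

lemma has_vector_derivative_trace:
  assumes F: "mat_deriv r r F D"
  shows "((\<lambda>s. mat_trace (F s)) has_vector_derivative mat_trace D) (at 0)"
proof -
  note c = mat_deriv_carrier[OF F]
  have "dim_row (F s) = r" for s using c(1)[of s] by simp
  then show ?thesis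
    using c(2) by (auto simp: mat_trace_def intro!: has_vector_derivative_sum mat_deriv_entry[OF F])
qed

section \<open>The Fisher metric\<close>

context herm_coordinates
begin

text \<open>Instances with the dimension fixed: their carrier premises contain no free dimension, so the simplifier
can discharge them for nested products.\<close>

lemmas square = assoc_mult_mat[of _ r r _ r _ r] mult_carrier_mat[of _ r r _ r]
  add_carrier_mat[of _ r r] add_mult_distrib_mat[of _ r r _ _ r] mult_add_distrib_mat[of _ r r _ r]

abbreviation G :: "complex mat \<Rightarrow> real mat" where
  "G \<xi> \<equiv> metric_mat fisher_metric n b \<xi>"

lemma G_carrier: "G \<xi> \<in> carrier_mat n n"
  by (simp add: metric_mat_def)

context
  fixes \<xi> Y assumes \<xi>: "\<xi> \<in> herm_space d r" and det: "det \<xi> \<noteq> 0"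
  defines "Y \<equiv> ainv \<xi>"
begin

private lemma \<xi>c: "\<xi> \<in> carrier_mat r r" using \<xi> carrierI by blast

private lemma Yh: "Y \<in> herm_space d r" unfolding Y_def by (rule herm_ainv[OF d \<xi> det])

private lemma Yc: "Y \<in> carrier_mat r r" using Yh carrierI by blast

private lemma inv: "\<xi> * Y = 1\<^sub>m r" "Y * \<xi> = 1\<^sub>m r"
  unfolding Y_def by (rule ainv_inverse[OF \<xi>c det])+

lemma fisher_metric_eq:
  assumes u: "u \<in> carrier_mat r r" and w: "w \<in> carrier_mat r r"
  shows "fisher_metric \<xi> u w = Re (mat_trace ((Y * (u * Y)) * w))"
proof -
  have "fisher_metric \<xi> u w = Re (mat_trace (u * (Y * (w * Y))))"
    using Yc u w by (simp add: square fisher_metric_def fisher_op_def minv_eq_ainv[OF \<xi>c det] flip: Y_def)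
  also have "u * (Y * (w * Y)) = (u * (Y * w)) * Y" using Yc u w by (simp add: square)
  also have "mat_trace \<dots> = mat_trace (Y * (u * (Y * w)))"
    by (rule trace_mult_comm[of _ r r]) (use Yc u w in \<open>simp_all add: square\<close>)
  also have "Y * (u * (Y * w)) = (Y * (u * Y)) * w" using Yc u w by (simp add: square)
  finally show ?thesis .
qed

text \<open>Multiplying by the Gram matrix lowers the index: the coordinates of \<open>w\<close> become the values on the basis
of the linear form \<open>u \<mapsto> tr (\<xi>\<^sup>-\<^sup>1 w \<xi>\<^sup>-\<^sup>1 u)\<close>.\<close>

lemma metric_pairing:
  assumes w: "w \<in> herm_space d r" and i: "i < n"
  shows "(\<Sum>j<n. G \<xi> $$ (i, j) * coord j w) = Re (mat_trace ((Y * (w * Y)) * b i))"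
proof -
  have bc: "b i \<in> carrier_mat r r" and wc: "w \<in> carrier_mat r r" using b_carrier i w carrierI by auto
  then have C: "Y * (b i * Y) \<in> carrier_mat r r" using Yc by (simp add: square)
  have "(\<Sum>j<n. G \<xi> $$ (i, j) * coord j w) = (\<Sum>j<n. coord j w * Re (mat_trace ((Y * (b i * Y)) * b j)))"
    using i bc by (intro sum.cong refl) (simp add: metric_mat_def fisher_metric_eq b_carrier)
  also have "\<dots> = Re (mat_trace ((Y * (b i * Y)) * w))"
    by (rule trace_expand[OF w C, symmetric])
  also have "(Y * (b i * Y)) * w = (Y * b i) * (Y * w)" using Yc bc wc by (simp add: square)
  also have "mat_trace \<dots> = mat_trace ((Y * w) * (Y * b i))"
    by (rule trace_mult_comm[of _ r r]) (use Yc bc wc in \<open>simp_all add: square\<close>)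
  also have "(Y * w) * (Y * b i) = (Y * (w * Y)) * b i" using Yc bc wc by (simp add: square)
  finally show ?thesis .
qed

text \<open>If \<open>w\<close> is orthogonal to the whole basis, then \<open>u = \<xi>\<^sup>-\<^sup>1 w \<xi>\<^sup>-\<^sup>1\<close> has \<open>tr (u u) = 0\<close>, and \<open>tr (u u)\<close> is
the sum of the squared moduli of the entries of \<open>u\<close>.\<close>

lemma metric_det_nonzero: "det (G \<xi>) \<noteq> 0"
proof
  assume "det (G \<xi>) = 0"
  then obtain v where v: "v \<in> carrier_vec n" "v \<noteq> 0\<^sub>v n" "G \<xi> *\<^sub>v v = 0\<^sub>v n"
    using det_0_iff_vec_prod_zero_field[OF G_carrier] by blast
  define w where "w = mat r r (\<lambda>(p, q). \<Sum>i<n. complex_of_real (v $ i) * b i $$ (p, q))"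
  have ent: "cnj (b i $$ (q, p)) = b i $$ (p, q)" if "i < n" "p < r" "q < r" for i p q
    using hermD[OF d b_herm[OF that(1)]] adjoint_index[of p "b i" q] that by auto
  have entT: "b i $$ (q, p) = b i $$ (p, q)" if "d = 1" "i < n" "p < r" "q < r" for i p q
    using hermD(1)[OF d b_herm[OF that(2)]] hermD(3)[OF d b_herm[OF that(2)] that(1)] that
    by (metis carrier_matD index_transpose_mat(1))
  have w: "w \<in> herm_space d r"
  proof (rule hermI[OF d])
    show "w \<in> carrier_mat r r" by (simp add: w_def)
    show "mat_adjoint w = w"
      unfolding w_def by (rule eq_matI) (simp_all add: ent)
    show "transpose_mat w = w" if "d = 1"
      unfolding w_def by (rule eq_matI) (simp_all add: entT[OF that])
  qed
  have wc: "w \<in> carrier_mat r r" using w carrierI by blast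
  have "expands w (\<lambda>i. v $ i)" by (simp add: expands_def w_def)
  then have coord_w: "coord i w = v $ i" if "i < n" for i using coord_unique[OF w] that by blast
  define u where "u = Y * (w * Y)"
  have uh: "u \<in> herm_space d r" unfolding u_def by (rule herm_sandwich[OF d Yh w])
  have uc: "u \<in> carrier_mat r r" using uh carrierI by blast
  have "Re (mat_trace (u * b i)) = 0" if i: "i < n" for i
  proof -
    have "(G \<xi> *\<^sub>v v) $ i = (\<Sum>j<n. G \<xi> $$ (i, j) * v $ j)"
      using i v(1) G_carrier[of \<xi>] by (simp add: scalar_prod_def atLeast0LessThan)
    also have "\<dots> = Re (mat_trace (u * b i))"
      using metric_pairing[OF w i] by (simp add: coord_w u_def)
    finally show ?thesis using v(3) i by simp
  qed
  then have "Re (mat_trace (u * u)) = 0"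
    using trace_expand[OF uh uc] by simp
  moreover have "Re (mat_trace (u * u)) = (\<Sum>p<r. \<Sum>q<r. (cmod (u $$ (p, q)))\<^sup>2)"
  proof -
    have "u $$ (q, p) = cnj (u $$ (p, q))" if "p < r" "q < r" for p q
      using hermD[OF d uh] adjoint_index[of q u p] that by auto
    then have "u $$ (p, q) * u $$ (q, p) = complex_of_real ((cmod (u $$ (p, q)))\<^sup>2)"
      if "p < r" "q < r" for p q
      using that by (metis complex_norm_square)
    moreover have "mat_trace (u * u) = (\<Sum>p<r. \<Sum>q<r. u $$ (p, q) * u $$ (q, p))"
      using uc by (simp add: mat_trace_def index_mult_sum[OF uc uc] del: index_mult_mat(1))
    ultimately have "mat_trace (u * u) = (\<Sum>p<r. \<Sum>q<r. complex_of_real ((cmod (u $$ (p, q)))\<^sup>2))"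
      by simp
    then show ?thesis by simp
  qed
  ultimately have "(\<Sum>p<r. \<Sum>q<r. (cmod (u $$ (p, q)))\<^sup>2) = 0" by simp
  then have "u $$ (p, q) = 0" if "p < r" "q < r" for p q
    using that by (simp add: sum_nonneg_eq_0_iff sum_nonneg)
  then have u0: "u = 0\<^sub>m r r" using uc by (intro eq_matI) auto
  have "w = (\<xi> * Y) * (w * (Y * \<xi>))" using wc inv by simp
  also have "\<dots> = \<xi> * (u * \<xi>)" unfolding u_def using \<xi>c Yc wc by (simp add: square)
  also have "\<dots> = 0\<^sub>m r r" using u0 \<xi>c by simp
  finally have "coord i w = 0" for i by (simp add: coord_def)
  then have "v = 0\<^sub>v n" using coord_w v(1) by (intro eq_vecI) auto
  then show False using v(2) by simp
qed

lemma metric_raise: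
  assumes V: "V \<in> herm_space d r" and i: "i < n"
  shows "(\<Sum>j<n. minv (G \<xi>) $$ (i, j) * Re (mat_trace ((Y * (V * Y)) * b j))) = coord i V"
proof -
  let ?M = "ainv (G \<xi>)"
  have M: "?M \<in> carrier_mat n n" using G_carrier by simp
  have MG: "?M * G \<xi> = 1\<^sub>m n" by (rule ainv_inverse(2)[OF G_carrier metric_det_nonzero])
  have "(\<Sum>j<n. minv (G \<xi>) $$ (i, j) * Re (mat_trace ((Y * (V * Y)) * b j)))
      = (\<Sum>j<n. \<Sum>k<n. ?M $$ (i, j) * G \<xi> $$ (j, k) * coord k V)"
    by (intro sum.cong refl)
      (simp add: metric_pairing[OF V, symmetric] minv_eq_ainv[OF G_carrier metric_det_nonzero]
        sum_distrib_left mult.assoc)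
  also have "\<dots> = (\<Sum>k<n. (\<Sum>j<n. ?M $$ (i, j) * G \<xi> $$ (j, k)) * coord k V)"
    by (subst sum.swap) (simp add: sum_distrib_right)
  also have "\<dots> = (\<Sum>k<n. if i = k then coord k V else 0)"
    by (intro sum.cong refl) (use i in \<open>simp add: index_mult_sum[OF M G_carrier, symmetric] MG\<close>)
  also have "\<dots> = coord i V" using i by simp
  finally show ?thesis .
qed

text \<open>Differentiating the Gram matrix produces, column by column, minus the Gram matrix applied to the
coordinates of \<open>w \<xi>\<^sup>-\<^sup>1 b\<^sub>j + b\<^sub>j \<xi>\<^sup>-\<^sup>1 w\<close>.  Jacobi's formula therefore gives minus the trace of the operator
\<open>u \<mapsto> w \<xi>\<^sup>-\<^sup>1 u + u \<xi>\<^sup>-\<^sup>1 w\<close> as the logarithmic derivative of the determinant.\<close>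

lemma sqrt_metric_has_derivative:
  assumes w: "w \<in> herm_space d r"
  shows "(line_fun (\<lambda>\<eta>. sqrt (det (G \<eta>))) \<xi> w has_real_derivative
     sqrt (det (G \<xi>)) * (- nu * Re (mat_trace (Y * w)))) (at 0)"
proof -
  define F where "F = (\<lambda>s. \<xi> + complex_of_real s \<cdot>\<^sub>m w)"
  have wc: "w \<in> carrier_mat r r" using w carrierI by blast
  have F: "mat_deriv r r F w" unfolding F_def by (rule mat_deriv_line[OF \<xi>c wc])
  note Fc = mat_deriv_carrier(1)[OF F]
  have F0: "F 0 = \<xi>" unfolding F_def using \<xi>c wc by (intro eq_matI) auto
  have dF0: "det (F 0) \<noteq> 0" using det F0 by simp
  have ev: "eventually (\<lambda>s. det (F s) \<noteq> 0) (nhds 0)" by (rule det_eventually_nonzero[OF F dF0])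
  define Ys where "Ys = (\<lambda>s. ainv (F s))"
  have Ys: "mat_deriv r r Ys (- (Y * (w * Y)))"
    using mat_deriv_ainv[OF F dF0] by (simp add: Ys_def F0 Y_def)
  have Ys0: "Ys 0 = Y" by (simp add: Ys_def F0 Y_def)
  have Ysc: "Ys s \<in> carrier_mat r r" for s using mat_deriv_carrier(1)[OF Ys] .
  define L where "L = (\<lambda>u. w * (Y * u) + u * (Y * w))"
  have Lh: "L (b j) \<in> herm_space d r" if "j < n" for j
    unfolding L_def by (rule herm_jordan[OF d w Yh b_herm[OF that]])
  define D where "D = mat n n (\<lambda>(i, j). - (\<Sum>k<n. G \<xi> $$ (i, k) * coord k (L (b j))))"
  have "mat_deriv n n (\<lambda>s. G (F s)) D"
    unfolding mat_deriv_def
  proof (intro conjI allI impI)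
    show "G (F s) \<in> carrier_mat n n" for s by (rule G_carrier)
    show "D \<in> carrier_mat n n" by (simp add: D_def)
    fix i j assume ij: "i < n" "j < n"
    have bc: "b i \<in> carrier_mat r r" "b j \<in> carrier_mat r r" using b_carrier ij by auto
    define X where "X = - (Y * (w * Y))"
    have Xc: "X \<in> carrier_mat r r" using Yc wc by (simp add: X_def square)
    have "mat_deriv r r (\<lambda>s. Ys s * (b j * Ys s)) (X * (b j * Y) + Y * (b j * X))"
      using mat_deriv_mult[OF Ys mat_deriv_const_mult[OF bc(2) Ys]] by (simp add: Ys0 X_def)
    from mat_deriv_mult_const[OF bc(1) this]
    have E: "mat_deriv r r (\<lambda>s. (Ys s * (b j * Ys s)) * b i) ((X * (b j * Y) + Y * (b j * X)) * b i)" .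
    have sum: "X * (b j * Y) + Y * (b j * X) = - (Y * (L (b j) * Y))"
    proof -
      have e: "Y * (L (b j) * Y) = Y * (w * (Y * (b j * Y))) + Y * (b j * (Y * (w * Y)))"
        unfolding L_def using Yc wc bc
        by (simp add: square)
      have c1: "Y * (w * (Y * (b j * Y))) \<in> carrier_mat r r" "Y * (b j * (Y * (w * Y))) \<in> carrier_mat r r"
        using Yc wc bc by (simp_all add: square)
      have c2: "Y * (w * Y) \<in> carrier_mat r r" "w * Y \<in> carrier_mat r r" "b j * Y \<in> carrier_mat r r"
        "b j * (Y * (w * Y)) \<in> carrier_mat r r"
        using Yc wc bc by (simp_all add: square)
      have "X * (b j * Y) = - (Y * (w * (Y * (b j * Y))))"
        using Yc wc bc c2 unfolding X_def by (simp add: square)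
      moreover have "Y * (b j * X) = - (Y * (b j * (Y * (w * Y))))"
        using Yc wc bc c2 unfolding X_def by (simp add: square)
      ultimately show ?thesis unfolding e using c1
        by (intro eq_matI) (simp_all del: index_mult_mat(1))
    qed
    have "((\<lambda>s. Re (mat_trace ((Ys s * (b j * Ys s)) * b i))) has_real_derivative
        Re (mat_trace ((- (Y * (L (b j) * Y))) * b i))) (at 0)"
      unfolding has_real_derivative_iff_has_vector_derivative
      using has_vector_derivative_trace[OF E[unfolded sum]]
      by (rule bounded_linear.has_vector_derivative[OF bounded_linear_Re])
    moreover have "Re (mat_trace ((- (Y * (L (b j) * Y))) * b i)) = D $$ (i, j)"
    proof -
      have Lc: "L (b j) \<in> carrier_mat r r" using Lh[OF ij(2)] carrierI by blast
      have "mat_trace ((- (Y * (L (b j) * Y))) * b i) = - mat_trace ((Y * (L (b j) * Y)) * b i)"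
        using Lc Yc bc by (simp add: mat_trace_def sum_negf square del: index_mult_mat(1) assoc_mult_mat)
      then show ?thesis
        using ij metric_pairing[OF Lh[OF ij(2)] ij(1)] by (simp add: D_def)
    qed
    ultimately have der: "((\<lambda>s. Re (mat_trace ((Ys s * (b j * Ys s)) * b i))) has_vector_derivative
        D $$ (i, j)) (at 0)" by (simp add: has_real_derivative_iff_has_vector_derivative)
    have eq: "eventually (\<lambda>s. Re (mat_trace ((Ys s * (b j * Ys s)) * b i)) = G (F s) $$ (i, j)) (nhds 0)"
      using ev
    proof eventually_elim
      case (elim s)
      have Yss: "minv (F s) = Ys s" unfolding Ys_def by (rule minv_eq_ainv[OF Fc elim])
      have "G (F s) $$ (i, j) = Re (mat_trace (b i * (Ys s * (b j * Ys s))))"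
        using ij Ysc[of s] bc by (simp add: metric_mat_def fisher_metric_def fisher_op_def Yss square)
      also have "mat_trace (b i * (Ys s * (b j * Ys s))) = mat_trace ((Ys s * (b j * Ys s)) * b i)"
        by (rule trace_mult_comm[of _ r r]) (use Ysc[of s] bc in \<open>simp_all add: square\<close>)
      finally show ?case by simp
    qed
    show "((\<lambda>s. G (F s) $$ (i, j)) has_vector_derivative D $$ (i, j)) (at 0)"
      by (rule has_vector_derivative_cong_ev[OF eq der])
  qed
  then have "((\<lambda>s. det (G (F s))) has_real_derivative det (G \<xi>) * mat_trace (ainv (G \<xi>) * D)) (at 0)"
    using det_has_derivative_jacobi[of n "\<lambda>s. G (F s)" D] metric_det_nonzero
    by (simp add: F0 has_real_derivative_iff_has_vector_derivative)
  moreover have "mat_trace (ainv (G \<xi>) * D) = - 2 * nu * Re (mat_trace (Y * w))"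
  proof -
    let ?M = "ainv (G \<xi>)"
    have M: "?M \<in> carrier_mat n n" using G_carrier by simp
    have MG: "?M * G \<xi> = 1\<^sub>m n" by (rule ainv_inverse(2)[OF G_carrier metric_det_nonzero])
    have Dc: "D \<in> carrier_mat n n" by (simp add: D_def)
    have "(?M * D) $$ (i, i) = - coord i (L (b i))" if i: "i < n" for i
    proof -
      have "(?M * D) $$ (i, i) = - (\<Sum>j<n. \<Sum>k<n. ?M $$ (i, j) * G \<xi> $$ (j, k) * coord k (L (b i)))"
        unfolding index_mult_sum[OF M Dc i i]
        using i by (simp add: D_def sum_negf sum_distrib_left mult.assoc)
      also have "(\<Sum>j<n. \<Sum>k<n. ?M $$ (i, j) * G \<xi> $$ (j, k) * coord k (L (b i)))
          = (\<Sum>k<n. (\<Sum>j<n. ?M $$ (i, j) * G \<xi> $$ (j, k)) * coord k (L (b i)))"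
        by (subst sum.swap) (simp add: sum_distrib_right)
      also have "\<dots> = (\<Sum>k<n. if i = k then coord k (L (b i)) else 0)"
        by (intro sum.cong refl) (use i in \<open>simp add: index_mult_sum[OF M G_carrier, symmetric] MG\<close>)
      also have "\<dots> = coord i (L (b i))" using i by simp
      finally show ?thesis .
    qed
    then have "mat_trace (?M * D) = - (\<Sum>i<n. coord i (L (b i)))"
      using M by (simp add: mat_trace_def sum_negf del: index_mult_mat(1))
    also have "(\<Sum>i<n. coord i (L (b i))) = (\<Sum>i<n. coord i ((w * Y) * b i)) + (\<Sum>i<n. coord i (b i * (Y * w)))"
    proof -
      have "coord i (L (b i)) = coord i ((w * Y) * b i) + coord i (b i * (Y * w))" if "i < n" for i
        unfolding L_def using Yc wc b_carrier[OF that] by (simp add: coord_add square)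
      then show ?thesis by (simp add: sum.distrib)
    qed
    also have "\<dots> = 2 * nu * Re (mat_trace (Y * w))"
    proof -
      have "w * Y \<in> carrier_mat r r" "Y * w \<in> carrier_mat r r" using wc Yc by auto
      then show ?thesis
        using operator_trace_left operator_trace_right trace_mult_comm[OF wc Yc] by simp
    qed
    finally show ?thesis by simp
  qed
  ultimately have der: "((\<lambda>s. det (G (F s))) has_real_derivative
      det (G \<xi>) * (- 2 * nu * Re (mat_trace (Y * w)))) (at 0)" by simp
  \<comment> \<open>On negative numbers the root is the odd extension, so the logarithmic derivative is half that of the argument on both sides of 0.\<close>
  have sq: "(sqrt has_real_derivative sqrt x / (2 * x)) (at x)" if "x \<noteq> 0" for x :: real
  proof (rule DERIV_real_sqrt_generic[OF that])
    show "sqrt x / (2 * x) = inverse (sqrt x) / 2" if "x > 0"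
    proof -
      have "x = sqrt x * sqrt x" using that by simp
      then show ?thesis using that by (simp add: field_simps)
    qed
    show "sqrt x / (2 * x) = - inverse (sqrt x) / 2" if "x < 0"
    proof -
      have "x = - (sqrt x * sqrt x)" using that real_sqrt_mult_self[of x] by simp
      then show ?thesis using that by (simp add: field_simps)
    qed
  qed
  have sq0: "(sqrt has_real_derivative sqrt (det (G \<xi>)) / (2 * det (G \<xi>))) (at (det (G (F 0))))"
    using sq[OF metric_det_nonzero] by (simp only: F0)
  have "((\<lambda>s. sqrt (det (G (F s)))) has_real_derivative
      sqrt (det (G \<xi>)) / (2 * det (G \<xi>)) * (det (G \<xi>) * (- 2 * nu * Re (mat_trace (Y * w))))) (at 0)"
    by (rule DERIV_chain2[where f = sqrt and g = "\<lambda>s. det (G (F s))", OF sq0 der])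
  then show ?thesis
    using metric_det_nonzero by (simp add: line_fun_def[abs_def] F_def)
qed

end

end

section \<open>Power functions of trailing minors\<close>

text \<open>Products of powers of the trailing minors with offsets \<open>p a\<close>.  The formula is demanded wherever the
minors involved and the determinant are nonzero; by continuity this condition persists along short
line segments, so derivatives may be computed from the formula.\<close>

locale power_function = herm_coordinates +
  fixes I :: "nat set" and p :: "nat \<Rightarrow> nat" and e :: "nat \<Rightarrow> real"
    and f :: "complex mat \<Rightarrow> real"
  assumes finite_I: "finite I" and p_le: "a \<in> I \<Longrightarrow> p a \<le> r"
    and power: "\<lbrakk>\<xi> \<in> herm_space d r; det \<xi> \<noteq> 0; \<And>a. a \<in> I \<Longrightarrow> det (trail (p a) \<xi>) \<noteq> 0\<rbrakk>
      \<Longrightarrow> f \<xi> = exp (\<Sum>a\<in>I. e a * ln (rdet (trail (p a) \<xi>)))"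
begin

definition U :: "complex mat set" where
  "U = {\<xi> \<in> herm_space d r. det \<xi> \<noteq> 0 \<and> (\<forall>a\<in>I. det (trail (p a) \<xi>) \<noteq> 0)}"

lemma f_eq: "\<xi> \<in> U \<Longrightarrow> f \<xi> = exp (\<Sum>a\<in>I. e a * ln (rdet (trail (p a) \<xi>)))"
  by (rule power) (simp_all add: U_def)

lemma UD:
  assumes "\<xi> \<in> U"
  shows "\<xi> \<in> herm_space d r" "det \<xi> \<noteq> 0" "a \<in> I \<Longrightarrow> det (trail (p a) \<xi>) \<noteq> 0" "\<xi> \<in> carrier_mat r r"
  using assms carrierI by (auto simp: U_def)

abbreviation P :: "nat \<Rightarrow> complex mat \<Rightarrow> complex mat" where
  "P a \<xi> \<equiv> trail_inv (p a) \<xi>"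

text \<open>The logarithmic derivative of \<open>f\<close> at \<open>\<xi>\<close> in direction \<open>w\<close>.\<close>

definition score :: "complex mat \<Rightarrow> complex mat \<Rightarrow> real" where
  "score \<xi> w = (\<Sum>a\<in>I. e a * Re (mat_trace (P a \<xi> * w)))"

text \<open>The coordinates of the Riemannian gradient of \<open>ln f\<close>.\<close>

definition gradient :: "nat \<Rightarrow> complex mat \<Rightarrow> real" where
  "gradient i \<xi> = (\<Sum>a\<in>I. e a * coord i (\<xi> * (P a \<xi> * \<xi>)))"

lemma line_in_U:
  assumes \<xi>: "\<xi> \<in> U" and w: "w \<in> herm_space d r"
  shows "eventually (\<lambda>s. \<xi> + complex_of_real s \<cdot>\<^sub>m w \<in> U) (nhds 0)"
proof -
  let ?F = "\<lambda>s. \<xi> + complex_of_real s \<cdot>\<^sub>m w"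
  have wc: "w \<in> carrier_mat r r" using w carrierI by blast
  note F = mat_deriv_line[OF UD(4)[OF \<xi>] wc]
  have F0: "?F 0 = \<xi>" using UD(4)[OF \<xi>] wc by (intro eq_matI) auto
  have 1: "eventually (\<lambda>s. det (?F s) \<noteq> 0) (nhds 0)"
    by (rule det_eventually_nonzero[OF F]) (unfold F0, rule UD(2)[OF \<xi>])
  have "eventually (\<lambda>s. det (trail (p a) (?F s)) \<noteq> 0) (nhds 0)" if "a \<in> I" for a
    by (rule det_eventually_nonzero[OF mat_deriv_trail[OF F]]) (unfold F0, rule UD(3)[OF \<xi> that])
  then have 2: "eventually (\<lambda>s. \<forall>a\<in>I. det (trail (p a) (?F s)) \<noteq> 0) (nhds 0)"
    using finite_I by (simp add: eventually_ball_finite)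
  show ?thesis
    using 1 2 by eventually_elim (simp add: U_def herm_line[OF d UD(1)[OF \<xi>] w])
qed

lemma f_has_derivative:
  assumes \<xi>: "\<xi> \<in> U" and w: "w \<in> herm_space d r"
  shows "(line_fun f \<xi> w has_real_derivative f \<xi> * score \<xi> w) (at 0)"
proof -
  let ?F = "\<lambda>s. \<xi> + complex_of_real s \<cdot>\<^sub>m w"
  have wc: "w \<in> carrier_mat r r" using w carrierI by blast
  note F = mat_deriv_line[OF UD(4)[OF \<xi>] wc]
  have F0: "?F 0 = \<xi>" using UD(4)[OF \<xi>] wc by (intro eq_matI) auto
  have "((\<lambda>s. ln (rdet (trail (p a) (?F s)))) has_real_derivative Re (mat_trace (P a \<xi> * w))) (at 0)"
    if "a \<in> I" for a
    using ln_trail_has_derivative[OF d F, unfolded F0, OF UD(1)[OF \<xi>] UD(3)[OF \<xi> that]] .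
  then have "((\<lambda>s. \<Sum>a\<in>I. e a * ln (rdet (trail (p a) (?F s)))) has_real_derivative score \<xi> w) (at 0)"
    unfolding score_def by (intro DERIV_sum DERIV_cmult) auto
  from DERIV_fun_exp[OF this]
  have "((\<lambda>s. exp (\<Sum>a\<in>I. e a * ln (rdet (trail (p a) (?F s))))) has_real_derivative f \<xi> * score \<xi> w) (at 0)"
    by (simp only: F0 f_eq[OF \<xi>])
  then have der: "((\<lambda>s. exp (\<Sum>a\<in>I. e a * ln (rdet (trail (p a) (?F s))))) has_vector_derivative f \<xi> * score \<xi> w) (at 0)"
    by (simp only: has_real_derivative_iff_has_vector_derivative)
  have "eventually (\<lambda>s. exp (\<Sum>a\<in>I. e a * ln (rdet (trail (p a) (?F s)))) = line_fun f \<xi> w s) (nhds 0)"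
    using line_in_U[OF \<xi> w] by eventually_elim (simp add: line_fun_def f_eq)
  from has_vector_derivative_cong_ev[OF this der]
  show ?thesis by (simp only: has_real_derivative_iff_has_vector_derivative)
qed

lemma P_facts:
  assumes \<xi>: "\<xi> \<in> U" and a: "a \<in> I"
  shows "P a \<xi> \<in> herm_space d r" "P a \<xi> \<in> carrier_mat r r"
    "ainv \<xi> * ((\<xi> * (P a \<xi> * \<xi>)) * ainv \<xi>) = P a \<xi>"
    "\<xi> * (P a \<xi> * \<xi>) \<in> herm_space d r"
proof -
  show Ph: "P a \<xi> \<in> herm_space d r"
    by (rule trail_inv_herm[OF UD(4)[OF \<xi>] UD(3)[OF \<xi> a] d UD(1)[OF \<xi>]])
  show Pc: "P a \<xi> \<in> carrier_mat r r" using Ph carrierI by blast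
  note xc = UD(4)[OF \<xi>]
  have Yc: "ainv \<xi> \<in> carrier_mat r r" using xc by simp
  define Y where "Y = ainv \<xi>"
  have Y: "Y \<in> carrier_mat r r" "Y * \<xi> = 1\<^sub>m r" "\<xi> * Y = 1\<^sub>m r"
    using Yc ainv_inverse[OF xc UD(2)[OF \<xi>]] by (auto simp: Y_def)
  have "Y * ((\<xi> * (P a \<xi> * \<xi>)) * Y) = (Y * \<xi>) * (P a \<xi> * (\<xi> * Y))"
    using Y(1) xc Pc by (simp add: square)
  then show "ainv \<xi> * ((\<xi> * (P a \<xi> * \<xi>)) * ainv \<xi>) = P a \<xi>"
    using Y Pc by (simp flip: Y_def)
  show "\<xi> * (P a \<xi> * \<xi>) \<in> herm_space d r" by (rule herm_sandwich[OF d UD(1)[OF \<xi>] Ph])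
qed

text \<open>Raising the index of the form \<open>w \<mapsto> tr (P\<^sub>a w)\<close> gives \<open>\<xi> P\<^sub>a \<xi>\<close>, because
\<open>\<xi>\<^sup>-\<^sup>1 (\<xi> P\<^sub>a \<xi>) \<xi>\<^sup>-\<^sup>1 = P\<^sub>a\<close>.\<close>

lemma flux_eq:
  assumes \<xi>: "\<xi> \<in> U" and i: "i < n"
  shows "LB_flux fisher_metric n b f i \<xi> = sqrt (det (G \<xi>)) * (f \<xi> * gradient i \<xi>)"
proof -
  have partial: "partial b j f \<xi> = f \<xi> * score \<xi> (b j)" if "j < n" for j
    unfolding partial_def by (rule DERIV_imp_deriv[OF f_has_derivative[OF \<xi> b_herm[OF that]]])
  have "(\<Sum>j<n. minv (G \<xi>) $$ (i, j) * partial b j f \<xi>)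
    = (\<Sum>j<n. \<Sum>a\<in>I. f \<xi> * e a * (minv (G \<xi>) $$ (i, j) * Re (mat_trace (P a \<xi> * b j))))"
    by (intro sum.cong refl) (simp add: partial score_def sum_distrib_left mult.assoc mult.left_commute)
  also have "\<dots> = (\<Sum>a\<in>I. f \<xi> * e a * (\<Sum>j<n. minv (G \<xi>) $$ (i, j) * Re (mat_trace (P a \<xi> * b j))))"
    by (subst sum.swap) (simp add: sum_distrib_left)
  also have "\<dots> = (\<Sum>a\<in>I. f \<xi> * e a * coord i (\<xi> * (P a \<xi> * \<xi>)))"
  proof (intro sum.cong refl)
    fix a assume a: "a \<in> I"
    show "f \<xi> * e a * (\<Sum>j<n. minv (G \<xi>) $$ (i, j) * Re (mat_trace (P a \<xi> * b j)))
      = f \<xi> * e a * coord i (\<xi> * (P a \<xi> * \<xi>))"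
      using metric_raise[OF UD(1,2)[OF \<xi>] P_facts(4)[OF \<xi> a] i] by (simp only: P_facts(3)[OF \<xi> a])
  qed
  also have "\<dots> = f \<xi> * gradient i \<xi>" by (simp add: gradient_def sum_distrib_left mult.assoc)
  finally show ?thesis by (simp add: LB_flux_def)
qed

definition gradient_deriv :: "nat \<Rightarrow> complex mat \<Rightarrow> complex mat \<Rightarrow> real" where
  "gradient_deriv i \<xi> w = (\<Sum>a\<in>I. e a * (coord i (w * (P a \<xi> * \<xi>)) + coord i ((\<xi> * P a \<xi>) * w)
      - coord i ((\<xi> * P a \<xi>) * (w * (P a \<xi> * \<xi>)))))"

lemma gradient_has_derivative:
  assumes \<xi>: "\<xi> \<in> U" and w: "w \<in> herm_space d r"
  shows "(line_fun (gradient i) \<xi> w has_real_derivative gradient_deriv i \<xi> w) (at 0)"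
proof -
  let ?F = "\<lambda>s. \<xi> + complex_of_real s \<cdot>\<^sub>m w"
  have wc: "w \<in> carrier_mat r r" using w carrierI by blast
  note xc = UD(4)[OF \<xi>]
  note F = mat_deriv_line[OF xc wc]
  have F0: "?F 0 = \<xi>" using xc wc by (intro eq_matI) auto
  have "((\<lambda>s. coord i (?F s * (P a (?F s) * ?F s))) has_real_derivative
      coord i (w * (P a \<xi> * \<xi>)) + coord i ((\<xi> * P a \<xi>) * w) - coord i ((\<xi> * P a \<xi>) * (w * (P a \<xi> * \<xi>)))) (at 0)"
    if a: "a \<in> I" for a
  proof -
    define Q where "Q = P a \<xi>"
    have Q: "Q \<in> carrier_mat r r" using P_facts(2)[OF \<xi> a] by (simp add: Q_def)
    have c: "w * (Q * \<xi>) \<in> carrier_mat r r" "\<xi> * (Q * w) \<in> carrier_mat r r"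
      "Q * (w * Q) \<in> carrier_mat r r" "\<xi> * (Q * (w * (Q * \<xi>))) \<in> carrier_mat r r"
      "Q * (w * (Q * \<xi>)) \<in> carrier_mat r r" "Q * w \<in> carrier_mat r r"
      using xc wc Q by (simp_all add: square)
    have dP: "mat_deriv r r (\<lambda>s. P a (?F s)) (- (Q * (w * Q)))"
      using mat_deriv_trail_inv[OF F, unfolded F0, OF UD(3)[OF \<xi> a]] by (simp only: Q_def)
    from mat_deriv_mult[OF F mat_deriv_mult[OF dP F]]
    have "mat_deriv r r (\<lambda>s. ?F s * (P a (?F s) * ?F s))
       (w * (Q * \<xi>) + \<xi> * (- (Q * (w * Q)) * \<xi> + Q * w))"
      by (simp only: F0 Q_def)
    from coord_has_derivative[OF this, of i]
    have "((\<lambda>s. coord i (?F s * (P a (?F s) * ?F s))) has_real_derivative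
       coord i (w * (Q * \<xi>) + \<xi> * (- (Q * (w * Q)) * \<xi> + Q * w))) (at 0)" .
    moreover have "coord i (w * (Q * \<xi>) + \<xi> * (- (Q * (w * Q)) * \<xi> + Q * w))
      = coord i (w * (Q * \<xi>)) + coord i ((\<xi> * Q) * w) - coord i ((\<xi> * Q) * (w * (Q * \<xi>)))"
    proof -
      have "- (Q * (w * Q)) * \<xi> = - (Q * (w * (Q * \<xi>)))"
        using c(3) xc wc Q by (simp add: square)
      moreover have "\<xi> * (- (Q * (w * (Q * \<xi>))) + Q * w) = - (\<xi> * (Q * (w * (Q * \<xi>)))) + \<xi> * (Q * w)"
        using xc c(5,6) carrier_matD[OF xc] carrier_matD[OF c(5)]
        by (simp add: mult_add_distrib_mat[of _ r r _ r])
      moreover have "(\<xi> * Q) * w = \<xi> * (Q * w)" "(\<xi> * Q) * (w * (Q * \<xi>)) = \<xi> * (Q * (w * (Q * \<xi>)))"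
        using xc wc Q by (simp_all add: square)
      ultimately show ?thesis
        using c by (simp add: coord_add coord_uminus del: assoc_mult_mat)
    qed
    ultimately show ?thesis by (simp add: Q_def)
  qed
  then show ?thesis
    unfolding line_fun_def[abs_def] gradient_def gradient_deriv_def
    by (intro DERIV_sum DERIV_cmult) auto
qed

lemma flux_has_derivative:
  assumes \<xi>: "\<xi> \<in> U" and i: "i < n" and w: "w \<in> herm_space d r"
  shows "(line_fun (LB_flux fisher_metric n b f i) \<xi> w has_real_derivative
    sqrt (det (G \<xi>)) * f \<xi> * ((score \<xi> w - nu * Re (mat_trace (ainv \<xi> * w))) * gradient i \<xi>
      + gradient_deriv i \<xi> w)) (at 0)"
proof -
  let ?F = "\<lambda>s. \<xi> + complex_of_real s \<cdot>\<^sub>m w"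
  have wc: "w \<in> carrier_mat r r" using w carrierI by blast
  have F0: "?F 0 = \<xi>" using UD(4)[OF \<xi>] wc by (intro eq_matI) auto
  have l0: "line_fun g \<xi> w 0 = g \<xi>" for g by (simp only: line_fun_def F0)
  have "((\<lambda>s. line_fun (\<lambda>\<eta>. sqrt (det (G \<eta>))) \<xi> w s * (line_fun f \<xi> w s * line_fun (gradient i) \<xi> w s))
      has_real_derivative
      sqrt (det (G \<xi>)) * (- nu * Re (mat_trace (ainv \<xi> * w))) * (f \<xi> * gradient i \<xi>)
      + (f \<xi> * score \<xi> w * gradient i \<xi> + gradient_deriv i \<xi> w * f \<xi>) * sqrt (det (G \<xi>))) (at 0)"
    using DERIV_mult[OF sqrt_metric_has_derivative[OF UD(1,2)[OF \<xi>] w]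
        DERIV_mult[OF f_has_derivative[OF \<xi> w] gradient_has_derivative[OF \<xi> w, of i]]]
    by (simp only: l0)
  then have der: "((\<lambda>s. line_fun (\<lambda>\<eta>. sqrt (det (G \<eta>))) \<xi> w s * (line_fun f \<xi> w s * line_fun (gradient i) \<xi> w s))
      has_vector_derivative
      sqrt (det (G \<xi>)) * f \<xi> * ((score \<xi> w - nu * Re (mat_trace (ainv \<xi> * w))) * gradient i \<xi>
      + gradient_deriv i \<xi> w)) (at 0)"
    by (simp add: has_real_derivative_iff_has_vector_derivative algebra_simps)
  have "eventually (\<lambda>s. line_fun (\<lambda>\<eta>. sqrt (det (G \<eta>))) \<xi> w s * (line_fun f \<xi> w s * line_fun (gradient i) \<xi> w s)
      = line_fun (LB_flux fisher_metric n b f i) \<xi> w s) (nhds 0)"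
    using line_in_U[OF \<xi> w] by eventually_elim (simp add: line_fun_def flux_eq[OF _ i])
  from has_vector_derivative_cong_ev[OF this der]
  show ?thesis by (simp only: has_real_derivative_iff_has_vector_derivative)
qed

abbreviation m :: "nat \<Rightarrow> real" where
  "m a \<equiv> real (r - p a)"

definition eigenvalue :: real where
  "eigenvalue = (\<Sum>a\<in>I. \<Sum>c\<in>I. e a * e c * min (m a) (m c))
     + real d / 2 * (\<Sum>a\<in>I. e a * m a * (real r - m a))"

lemma trace_P_self:
  assumes \<xi>: "\<xi> \<in> U" and a: "a \<in> I"
  shows "mat_trace (P a \<xi> * \<xi>) = complex_of_real (m a)" "mat_trace (\<xi> * P a \<xi>) = complex_of_real (m a)"
  using trace_trail_inv_self[OF UD(4)[OF \<xi>] UD(3)[OF \<xi> a]]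
    trace_mult_comm[OF UD(4)[OF \<xi>] P_facts(2)[OF \<xi> a]] by simp_all

lemma trace_P_P:
  assumes \<xi>: "\<xi> \<in> U" and a: "a \<in> I" and c: "c \<in> I"
  shows "mat_trace (P c \<xi> * (\<xi> * (P a \<xi> * \<xi>))) = complex_of_real (min (m a) (m c))"
proof -
  note xc = UD(4)[OF \<xi>] and Pa = P_facts(2)[OF \<xi> a] and Pc = P_facts(2)[OF \<xi> c]
  have nested: "mat_trace (P u \<xi> * (\<xi> * (P v \<xi> * \<xi>))) = complex_of_real (m v)"
    if uv: "u \<in> I" "v \<in> I" "p u \<le> p v" for u v
  proof -
    note Pu = P_facts(2)[OF \<xi> uv(1)] and Pv = P_facts(2)[OF \<xi> uv(2)]
    have "P u \<xi> * (\<xi> * (P v \<xi> * \<xi>)) = (P u \<xi> * (\<xi> * P v \<xi>)) * \<xi>"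
      by (rule assoc_mult_mat4[OF Pu xc Pv xc])
    then show ?thesis
      using trail_inv_nested[OF xc uv(3) UD(3)[OF \<xi> uv(1)] UD(3)[OF \<xi> uv(2)]] trace_P_self(1)[OF \<xi> uv(2)]
      by simp
  qed
  show ?thesis
  proof (cases "p c \<le> p a")
    case True
    then have "m a \<le> m c" by simp
    then show ?thesis using nested[OF c a True] by (simp add: min_def)
  next
    case False
    then have le: "p a \<le> p c" and "m c \<le> m a" by auto
    have "mat_trace (P c \<xi> * (\<xi> * (P a \<xi> * \<xi>))) = mat_trace ((P c \<xi> * \<xi>) * (P a \<xi> * \<xi>))"
      using assoc_mult_mat[OF Pc xc mult_carrier_mat[OF Pa xc]] by simp
    also have "\<dots> = mat_trace ((P a \<xi> * \<xi>) * (P c \<xi> * \<xi>))"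
      by (rule trace_mult_comm[OF mult_carrier_mat[OF Pc xc] mult_carrier_mat[OF Pa xc]])
    also have "\<dots> = mat_trace (P a \<xi> * (\<xi> * (P c \<xi> * \<xi>)))"
      using assoc_mult_mat[OF Pa xc mult_carrier_mat[OF Pc xc]] by simp
    finally show ?thesis using nested[OF a c le] \<open>m c \<le> m a\<close> by (simp add: min_def)
  qed
qed

text \<open>The value is the dimension of the space of symmetric or Hermitian matrices of size \<open>m\<^sub>a\<close>, since the
operator is a projection onto a copy of that space.\<close>

lemma projection_trace:
  assumes \<xi>: "\<xi> \<in> U" and a: "a \<in> I"
  shows "(\<Sum>i<n. coord i ((\<xi> * P a \<xi>) * (b i * (P a \<xi> * \<xi>)))) = m a + m a * (m a - 1) * real d / 2"
proof -
  note xc = UD(4)[OF \<xi>] and Pa = P_facts(2)[OF \<xi> a]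
  note tr = operator_trace[OF mult_carrier_mat[OF xc Pa] mult_carrier_mat[OF Pa xc]]
  show ?thesis
  proof (cases "d = 1")
    case True
    have "transpose_mat (P a \<xi> * \<xi>) = \<xi> * P a \<xi>"
      using transpose_mult[OF Pa xc] hermD(3)[OF d UD(1)[OF \<xi>] True] hermD(3)[OF d P_facts(1)[OF \<xi> a] True]
      by simp
    moreover have "mat_trace ((\<xi> * P a \<xi>) * (\<xi> * P a \<xi>)) = complex_of_real (m a)"
    proof -
      have "(\<xi> * P a \<xi>) * (\<xi> * P a \<xi>) = \<xi> * (P a \<xi> * (\<xi> * P a \<xi>))"
        by (rule assoc_mult_mat[OF xc Pa mult_carrier_mat[OF xc Pa]])
      then show ?thesis
        using trail_inv_nested[OF xc order_refl UD(3)[OF \<xi> a] UD(3)[OF \<xi> a]] trace_P_self(2)[OF \<xi> a] by simp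
    qed
    ultimately show ?thesis
      using True unfolding tr by (simp add: trace_P_self[OF \<xi> a] field_simps)
  next
    case False
    then have "d = 2" using d by simp
    then show ?thesis unfolding tr by (simp add: trace_P_self[OF \<xi> a] field_simps)
  qed
qed

text \<open>The product rule splits the divergence of the flux into three sums over the basis: the derivative of
\<open>f\<close> along the gradient, the derivative of the volume density along the gradient, and the divergence
of the coordinates of the gradient, a sum of operator traces.\<close>

theorem laplace_beltrami_power_function:
  assumes \<xi>: "\<xi> \<in> U"
  shows "laplace_beltrami fisher_metric n b f \<xi> = eigenvalue * f \<xi>"
proof -
  note xc = UD(4)[OF \<xi>]
  let ?V = "\<lambda>a. \<xi> * (P a \<xi> * \<xi>)"
  let ?S = "sqrt (det (G \<xi>))"
  have Sn: "?S \<noteq> 0" using metric_det_nonzero[OF UD(1,2)[OF \<xi>]] by simp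
  have expand: "(\<Sum>i<n. Re (mat_trace (C * b i)) * gradient i \<xi>) = (\<Sum>a\<in>I. e a * Re (mat_trace (C * ?V a)))"
    if C: "C \<in> carrier_mat r r" for C
  proof -
    have "(\<Sum>i<n. Re (mat_trace (C * b i)) * gradient i \<xi>)
      = (\<Sum>a\<in>I. \<Sum>i<n. e a * (coord i (?V a) * Re (mat_trace (C * b i))))"
      by (subst sum.swap) (simp add: gradient_def sum_distrib_left ac_simps)
    also have "\<dots> = (\<Sum>a\<in>I. e a * Re (mat_trace (C * ?V a)))"
      by (intro sum.cong refl) (simp add: trace_expand[OF P_facts(4)[OF \<xi>] C] sum_distrib_left)
    finally show ?thesis .
  qed
  have t1: "(\<Sum>i<n. score \<xi> (b i) * gradient i \<xi>) = (\<Sum>a\<in>I. \<Sum>c\<in>I. e a * e c * min (m a) (m c))"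
  proof -
    have "(\<Sum>i<n. score \<xi> (b i) * gradient i \<xi>)
      = (\<Sum>a\<in>I. e a * (\<Sum>i<n. Re (mat_trace (P a \<xi> * b i)) * gradient i \<xi>))"
      unfolding score_def sum_distrib_right by (subst sum.swap) (simp add: sum_distrib_left mult.assoc)
    also have "\<dots> = (\<Sum>a\<in>I. \<Sum>c\<in>I. e a * e c * min (m a) (m c))"
      by (intro sum.cong refl)
        (simp add: expand[OF P_facts(2)[OF \<xi>]] trace_P_P[OF \<xi>] sum_distrib_left mult.assoc min.commute)
    finally show ?thesis .
  qed
  have Yc: "ainv \<xi> \<in> carrier_mat r r" using xc by simp
  have YV: "ainv \<xi> * ?V a = P a \<xi> * \<xi>" if "a \<in> I" for a
  proof -
    note Pa = P_facts(2)[OF \<xi> that]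
    have "ainv \<xi> * ?V a = (ainv \<xi> * \<xi>) * (P a \<xi> * \<xi>)"
      by (rule assoc_mult_mat[OF Yc xc mult_carrier_mat[OF Pa xc], symmetric])
    then show ?thesis
      using ainv_inverse(2)[OF xc UD(2)[OF \<xi>]] left_mult_one_mat[OF mult_carrier_mat[OF Pa xc]] by simp
  qed
  have t2: "(\<Sum>i<n. Re (mat_trace (ainv \<xi> * b i)) * gradient i \<xi>) = (\<Sum>a\<in>I. e a * m a)"
    unfolding expand[OF Yc] by (intro sum.cong refl) (simp add: YV trace_P_self[OF \<xi>])
  have t3: "(\<Sum>i<n. gradient_deriv i \<xi> (b i))
      = (\<Sum>a\<in>I. e a * (2 * nu * m a - (m a + m a * (m a - 1) * real d / 2)))"
  proof -
    have "(\<Sum>i<n. gradient_deriv i \<xi> (b i)) = (\<Sum>a\<in>I. e a * ((\<Sum>i<n. coord i (b i * (P a \<xi> * \<xi>)))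
        + (\<Sum>i<n. coord i ((\<xi> * P a \<xi>) * b i)) - (\<Sum>i<n. coord i ((\<xi> * P a \<xi>) * (b i * (P a \<xi> * \<xi>))))))"
      unfolding gradient_deriv_def
      by (subst sum.swap) (simp only: sum.distrib sum_subtractf sum_distrib_left[symmetric])
    also have "\<dots> = (\<Sum>a\<in>I. e a * (2 * nu * m a - (m a + m a * (m a - 1) * real d / 2)))"
    proof (intro sum.cong refl)
      fix a assume a: "a \<in> I"
      note Pa = P_facts(2)[OF \<xi> a]
      show "e a * ((\<Sum>i<n. coord i (b i * (P a \<xi> * \<xi>))) + (\<Sum>i<n. coord i ((\<xi> * P a \<xi>) * b i))
          - (\<Sum>i<n. coord i ((\<xi> * P a \<xi>) * (b i * (P a \<xi> * \<xi>)))))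
        = e a * (2 * nu * m a - (m a + m a * (m a - 1) * real d / 2))"
        unfolding projection_trace[OF \<xi> a] operator_trace_right[OF mult_carrier_mat[OF Pa xc]]
          operator_trace_left[OF mult_carrier_mat[OF xc Pa]] trace_P_self[OF \<xi> a]
        by (simp add: algebra_simps)
    qed
    finally show ?thesis .
  qed
  have "(\<Sum>i<n. partial b i (LB_flux fisher_metric n b f i) \<xi>)
    = (\<Sum>i<n. ?S * f \<xi> * ((score \<xi> (b i) - nu * Re (mat_trace (ainv \<xi> * b i))) * gradient i \<xi>
        + gradient_deriv i \<xi> (b i)))"
    unfolding partial_def
    by (intro sum.cong refl DERIV_imp_deriv flux_has_derivative[OF \<xi>] b_herm) auto
  also have "\<dots> = ?S * f \<xi> * ((\<Sum>i<n. score \<xi> (b i) * gradient i \<xi>)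
      - nu * (\<Sum>i<n. Re (mat_trace (ainv \<xi> * b i)) * gradient i \<xi>) + (\<Sum>i<n. gradient_deriv i \<xi> (b i)))"
    unfolding sum_distrib_left[symmetric]
    by (simp add: sum.distrib sum_subtractf sum_distrib_left left_diff_distrib mult.assoc)
  also have "\<dots> = ?S * f \<xi> * eigenvalue"
  proof -
    have "- nu * (\<Sum>a\<in>I. e a * m a) + (\<Sum>a\<in>I. e a * (2 * nu * m a - (m a + m a * (m a - 1) * real d / 2)))
      = real d / 2 * (\<Sum>a\<in>I. e a * m a * (real r - m a))"
      unfolding sum_distrib_left sum.distrib[symmetric]
      by (intro sum.cong refl) (simp add: nu_def field_simps)
    then show ?thesis
      unfolding t1 t2 t3 eigenvalue_def by simp
  qed
  finally show ?thesis using Sn by (simp add: laplace_beltrami_def)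
qed

lemma power_function_differentiable:
  assumes \<xi>: "\<xi> \<in> U" and i: "i < n"
  shows "line_fun f \<xi> (b i) differentiable (at 0)"
    "line_fun (LB_flux fisher_metric n b f i) \<xi> (b i) differentiable (at 0)"
  using f_has_derivative[OF \<xi> b_herm[OF i]] flux_has_derivative[OF \<xi> i b_herm[OF i]]
  by (auto simp: real_differentiable_def)

end

section \<open>Iterated Schur complements\<close>

text \<open>Block elimination: the matrix factors as a unit upper triangular block matrix times a lower triangular
one with diagonal blocks the Schur complement and \<open>A4\<close>.\<close>

lemma det_schur:
  fixes A1 A2 A3 A4 :: "'a :: field mat"
  assumes A1: "A1 \<in> carrier_mat m m" and A2: "A2 \<in> carrier_mat m k"
    and A3: "A3 \<in> carrier_mat k m" and A4: "A4 \<in> carrier_mat k k" and det: "det A4 \<noteq> 0"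
  shows "det (four_block_mat A1 A2 A3 A4) = det (A1 - A2 * (ainv A4 * A3)) * det A4"
proof -
  define B where "B = ainv A4"
  have B: "B \<in> carrier_mat k k" and BA: "B * A4 = 1\<^sub>m k"
    using A4 ainv_inverse(2)[OF A4 det] by (auto simp: B_def)
  note BA3 = mult_carrier_mat[OF B A3] and AB = mult_carrier_mat[OF A2 B]
  note ABA = mult_carrier_mat[OF A2 BA3]
  define S where "S = A1 - A2 * (B * A3)"
  have S: "S \<in> carrier_mat m m" unfolding S_def using ABA by (rule minus_carrier_mat)
  let ?L = "four_block_mat (1\<^sub>m m) (A2 * B) (0\<^sub>m k m) (1\<^sub>m k)"
  let ?R = "four_block_mat S (0\<^sub>m m k) A3 A4"
  have "S + (A2 * B) * A3 = A1"
    using assoc_mult_mat[OF A2 B A3] A1 ABA carrier_matD[OF ABA] unfolding S_def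
    by (intro eq_matI) (simp_all del: index_mult_mat(1) assoc_mult_mat)
  moreover have "(A2 * B) * A4 = A2" using assoc_mult_mat[OF A2 B A4] BA A2 by simp
  ultimately have "?L * ?R = four_block_mat A1 A2 A3 A4"
    using mult_four_block_mat[OF one_carrier_mat AB zero_carrier_mat one_carrier_mat S zero_carrier_mat A3 A4]
      left_mult_one_mat[OF S] left_mult_one_mat[OF A3] left_mult_one_mat[OF A4] left_mult_zero_mat[OF S]
      A2 A3 A4 by simp
  moreover have "det (?L * ?R) = det ?L * det ?R"
    by (rule det_mult[of _ "m + k"]) (use S A4 in auto)
  moreover have "det ?L = 1"
    using det_four_block_mat_lower_left_zero[OF one_carrier_mat AB refl one_carrier_mat] by simp
  moreover have "det ?R = det S * det A4"
    by (rule det_four_block_mat_upper_right_zero[OF S refl A3 A4])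
  ultimately show ?thesis by (simp add: S_def B_def)
qed

context
  fixes d N m :: nat and A A1 A2 B :: "complex mat"
  assumes d: "d \<in> {1, 2}" and A: "A \<in> herm_space d N" and m: "m \<le> N"
    and det: "det (trail m A) \<noteq> 0"
  defines "A1 \<equiv> mat m m (\<lambda>ij. A $$ ij)" and "A2 \<equiv> mat m (N - m) (\<lambda>(i, j). A $$ (i, j + m))"
    and "B \<equiv> ainv (trail m A)"
begin

private lemma Ac: "A \<in> carrier_mat N N" using herm_carrier[OF d A] .

private lemma Bh: "B \<in> herm_space d (N - m)"
  unfolding B_def by (rule herm_ainv[OF d trail_herm[OF d A] det])

private lemma dims: "A1 \<in> carrier_mat m m" "A2 \<in> carrier_mat m (N - m)"
  "mat_adjoint A2 \<in> carrier_mat (N - m) m" "B \<in> carrier_mat (N - m) (N - m)"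
  using herm_carrier[OF d Bh] by (simp_all add: A1_def A2_def)

private lemma schur: "schur_compl m A = A1 - A2 * (B * mat_adjoint A2)"
proof -
  have "split_block A m m = (A1, A2, mat (N - m) m (\<lambda>(i, j). A $$ (i + m, j)), trail m A)"
    using Ac by (simp add: split_block_def Let_def A1_def A2_def trail_def)
  then show ?thesis
    using assoc_mult_mat[OF dims(2) dims(4) dims(3)] minv_eq_ainv[OF trail_carrier[OF Ac] det]
    by (simp add: schur_compl_def B_def)
qed

private lemma ent: "i < N \<Longrightarrow> j < N \<Longrightarrow> cnj (A $$ (j, i)) = A $$ (i, j)"
  using hermD[OF d A] adjoint_index[of i A j] by auto

private lemma entT: "d = 1 \<Longrightarrow> i < N \<Longrightarrow> j < N \<Longrightarrow> A $$ (j, i) = A $$ (i, j)"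
  using hermD(3)[OF d A] Ac by (metis carrier_matD index_transpose_mat(1))

private lemmas BA = mult_carrier_mat[OF dims(4) dims(3)]
private lemmas ABA = mult_carrier_mat[OF dims(2) BA]

lemma schur_compl_herm: "schur_compl m A \<in> herm_space d m"
  unfolding schur
proof (rule hermI[OF d])
  show "A1 - A2 * (B * mat_adjoint A2) \<in> carrier_mat m m" using ABA by (rule minus_carrier_mat)
  have eq: "mat_adjoint (X - Z) = mat_adjoint X - mat_adjoint Z"
    "transpose_mat (X - Z) = transpose_mat X - transpose_mat Z"
    if "X \<in> carrier_mat m m" "Z \<in> carrier_mat m m" for X Z :: "complex mat"
    by (rule eq_matI; use that in auto)+
  have "mat_adjoint A1 = A1" using m by (intro eq_matI) (simp_all add: A1_def ent)
  moreover have "mat_adjoint (A2 * (B * mat_adjoint A2)) = A2 * (B * mat_adjoint A2)"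
    using adjoint_mult[OF dims(2) BA] adjoint_mult[OF dims(4,3)] hermD(2)[OF d Bh] assoc_mult_mat[OF dims(2,4,3)]
    by (simp add: adjoint_adjoint)
  ultimately show "mat_adjoint (A1 - A2 * (B * mat_adjoint A2)) = A1 - A2 * (B * mat_adjoint A2)"
    using eq(1)[OF dims(1) ABA] by simp
  show "transpose_mat (A1 - A2 * (B * mat_adjoint A2)) = A1 - A2 * (B * mat_adjoint A2)" if "d = 1"
  proof -
    have "cnj (A $$ (i, j)) = A $$ (i, j)" if "i < N" "j < N" for i j
      using ent[OF that(2,1)] entT[OF \<open>d = 1\<close> that] by simp
    then have T: "mat_adjoint A2 = transpose_mat A2" "transpose_mat (mat_adjoint A2) = A2"
      using m by (intro eq_matI; simp add: A2_def)+
    have "transpose_mat A1 = A1" using m by (intro eq_matI) (simp_all add: A1_def entT[OF that])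
    moreover have "transpose_mat (A2 * (B * mat_adjoint A2)) = A2 * (B * mat_adjoint A2)"
      using transpose_mult[OF dims(2) BA] transpose_mult[OF dims(4,3)] hermD(3)[OF d Bh that]
        assoc_mult_mat[OF dims(2,4,3)] T by simp
    ultimately show ?thesis using eq(2)[OF dims(1) ABA] by simp
  qed
qed

text \<open>A trailing block of the Schur complement is the Schur complement of the corresponding larger trailing
block, so \<open>det_schur\<close> applies to each of them.\<close>

lemma det_trail_schur_compl:
  assumes p: "p \<le> m"
  shows "det (trail p A) = det (trail p (schur_compl m A)) * det (trail m A)"
proof -
  let ?k = "N - m"
  define X1 where "X1 = trail p A1"
  define X2 where "X2 = mat (m - p) ?k (\<lambda>(i, j). A $$ (i + p, j + m))"
  define X3 where "X3 = mat ?k (m - p) (\<lambda>(i, j). A $$ (i + m, j + p))"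
  have X: "X1 \<in> carrier_mat (m - p) (m - p)" "X2 \<in> carrier_mat (m - p) ?k" "X3 \<in> carrier_mat ?k (m - p)"
    using trail_carrier[OF dims(1)] by (simp_all add: X1_def X2_def X3_def)
  have T: "trail m A \<in> carrier_mat ?k ?k" by (rule trail_carrier[OF Ac])
  have Np: "N - p = (m - p) + ?k" using p m by simp
  have F: "four_block_mat X1 X2 X3 (trail m A) \<in> carrier_mat (N - p) (N - p)"
    unfolding Np by (rule four_block_carrier_mat[OF X(1) T])
  have "trail p A = four_block_mat X1 X2 X3 (trail m A)"
  proof (rule eq_matI)
    show "dim_row (trail p A) = dim_row (four_block_mat X1 X2 X3 (trail m A))"
      "dim_col (trail p A) = dim_col (four_block_mat X1 X2 X3 (trail m A))"
      using carrier_matD[OF F] carrier_matD[OF trail_carrier[OF Ac, of p]] by simp_all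
    fix i j assume "i < dim_row (four_block_mat X1 X2 X3 (trail m A))"
      "j < dim_col (four_block_mat X1 X2 X3 (trail m A))"
    then have ij: "i < N - p" "j < N - p" using carrier_matD[OF F] by simp_all
    then have 1: "four_block_mat X1 X2 X3 (trail m A) $$ (i, j)
      = (if i < m - p then if j < m - p then X1 $$ (i, j) else X2 $$ (i, j - (m - p))
         else if j < m - p then X3 $$ (i - (m - p), j) else trail m A $$ (i - (m - p), j - (m - p)))"
      using ij by (subst index_mat_four_block(1)) (simp_all only: carrier_matD[OF X(1)] carrier_matD[OF T] Np)
    have low: "l - (m - p) + m = l + p" "l - (m - p) < ?k" if "\<not> l < m - p" "l < N - p" for l
      using that p m by simp_all
    have "four_block_mat X1 X2 X3 (trail m A) $$ (i, j) = A $$ (i + p, j + p)"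
    proof (cases "i < m - p"; cases "j < m - p")
      assume "i < m - p" "j < m - p"
      then show ?thesis unfolding 1 by (simp add: X1_def A1_def trail_def)
    next
      assume a: "i < m - p" "\<not> j < m - p"
      then show ?thesis unfolding 1 using low[OF a(2) ij(2)] by (simp add: X2_def)
    next
      assume a: "\<not> i < m - p" "j < m - p"
      then show ?thesis unfolding 1 using low[OF a(1) ij(1)] by (simp add: X3_def)
    next
      assume a: "\<not> i < m - p" "\<not> j < m - p"
      then show ?thesis unfolding 1
        using low[OF a(1) ij(1)] low[OF a(2) ij(2)] by (simp add: trail_index[OF Ac])
    qed
    then show "trail p A $$ (i, j) = four_block_mat X1 X2 X3 (trail m A) $$ (i, j)"
      by (simp only: trail_index[OF Ac ij])
  qed
  then have "det (trail p A) = det (X1 - X2 * (B * X3)) * det (trail m A)"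
    using det_schur[OF X T det] by (simp add: B_def)
  moreover have "X1 - X2 * (B * X3) = trail p (schur_compl m A)"
  proof (rule eq_matI)
    have S: "schur_compl m A \<in> carrier_mat m m" using herm_carrier[OF d schur_compl_herm] .
    note BX = mult_carrier_mat[OF dims(4) X(3)]
    note XBX = mult_carrier_mat[OF X(2) BX]
    show "dim_row (X1 - X2 * (B * X3)) = dim_row (trail p (schur_compl m A))"
      "dim_col (X1 - X2 * (B * X3)) = dim_col (trail p (schur_compl m A))"
      using carrier_matD[OF XBX] carrier_matD[OF trail_carrier[OF S, of p]] by simp_all
    fix i j assume "i < dim_row (trail p (schur_compl m A))" "j < dim_col (trail p (schur_compl m A))"
    then have ij: "i < m - p" "j < m - p" using carrier_matD[OF trail_carrier[OF S, of p]] by simp_all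
    then have ij': "i + p < m" "j + p < m" by simp_all
    have "(X2 * (B * X3)) $$ (i, j) = (\<Sum>k<?k. X2 $$ (i, k) * (\<Sum>l<?k. B $$ (k, l) * X3 $$ (l, j)))"
      unfolding index_mult_sum[OF X(2) BX ij]
      by (intro sum.cong refl) (simp add: index_mult_sum[OF dims(4) X(3) _ ij(2)] del: index_mult_mat(1))
    also have "\<dots> = (\<Sum>k<?k. A2 $$ (i + p, k) * (\<Sum>l<?k. B $$ (k, l) * mat_adjoint A2 $$ (l, j + p)))"
    proof (intro sum.cong refl arg_cong2[where f = "(*)"])
      fix k assume "k \<in> {..<?k}"
      then show "X2 $$ (i, k) = A2 $$ (i + p, k)" using ij ij' by (simp add: X2_def A2_def)
    next
      fix l assume "l \<in> {..<?k}"
      then have "l < ?k" by simp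
      then show "X3 $$ (l, j) = mat_adjoint A2 $$ (l, j + p)"
        using ij ij' m by (simp add: X3_def A2_def ent)
    qed
    also have "\<dots> = (A2 * (B * mat_adjoint A2)) $$ (i + p, j + p)"
      unfolding index_mult_sum[OF dims(2) BA ij']
      by (intro sum.cong refl) (simp add: index_mult_sum[OF dims(4,3) _ ij'(2)] del: index_mult_mat(1))
    finally have e: "(X2 * (B * X3)) $$ (i, j) = (A2 * (B * mat_adjoint A2)) $$ (i + p, j + p)" .
    have "(X1 - X2 * (B * X3)) $$ (i, j) = X1 $$ (i, j) - (X2 * (B * X3)) $$ (i, j)"
      using ij carrier_matD[OF XBX] by (simp del: index_mult_mat(1))
    also have "\<dots> = (A1 - A2 * (B * mat_adjoint A2)) $$ (i + p, j + p)"
      using ij ij' carrier_matD[OF ABA] unfolding e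
      by (simp add: X1_def trail_index[OF dims(1)] del: index_mult_mat(1))
    also have "\<dots> = trail p (schur_compl m A) $$ (i, j)"
      unfolding schur by (rule trail_index[OF S[unfolded schur] ij, symmetric])
    finally show "(X1 - X2 * (B * X3)) $$ (i, j) = trail p (schur_compl m A) $$ (i, j)" .
  qed
  ultimately show ?thesis by simp
qed

end

lemma psum_Suc: "psum k (Suc i) = psum k i + k (Suc i)"
  by (simp add: psum_def)

lemma psum_0 [simp]: "psum k 0 = 0"
  by (simp add: psum_def)

lemma psum_mono: "i \<le> j \<Longrightarrow> psum k i \<le> psum k j"
  unfolding psum_def by (rule sum_mono2) auto

text \<open>Downward induction.  Nonvanishing of the minors of \<open>\<xi>\<close> makes the block that is eliminated in each step
invertible, and the factors of \<open>det_trail_schur_compl\<close> telescope.\<close>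

lemma det_trail_zeta:
  assumes d: "d \<in> {1, 2}" and \<xi>: "\<xi> \<in> herm_space d (psum k h)"
    and det: "\<And>i. i \<le> h \<Longrightarrow> det (trail (psum k i) \<xi>) \<noteq> 0"
    and i: "i \<le> h"
  shows "zeta k h \<xi> i \<in> herm_space d (psum k i) \<and>
    (\<forall>p \<le> psum k i. det (trail p \<xi>) = det (trail p (zeta k h \<xi> i)) * det (trail (psum k i) \<xi>))"
  using i
proof (induction i rule: inc_induct)
  case base
  have "trail (psum k h) \<xi> \<in> carrier_mat 0 0"
    using trail_carrier[OF herm_carrier[OF d \<xi>], of "psum k h"] by simp
  then show ?case using \<xi> by (simp add: zeta.simps[of k h \<xi> h])
next
  case (step i)
  let ?z = "zeta k h \<xi> (Suc i)"
  have z: "?z \<in> herm_space d (psum k (Suc i))"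
    and f: "\<And>p. p \<le> psum k (Suc i) \<Longrightarrow>
      det (trail p \<xi>) = det (trail p ?z) * det (trail (psum k (Suc i)) \<xi>)"
    using step.IH by blast+
  have le: "psum k i \<le> psum k (Suc i)" by (rule psum_mono) simp
  have nz: "det (trail (psum k i) ?z) \<noteq> 0"
    using f[OF le] det[of i] step.hyps by (metis less_imp_le_nat mult_eq_0_iff)
  have zi: "zeta k h \<xi> i = schur_compl (psum k i) ?z"
    using step.hyps by (simp add: zeta.simps[of k h \<xi> i])
  have "det (trail p \<xi>) = det (trail p (schur_compl (psum k i) ?z)) * det (trail (psum k i) \<xi>)"
    if p: "p \<le> psum k i" for p
  proof -
    have "p \<le> psum k (Suc i)" using p le by simp
    then have "det (trail p \<xi>) = det (trail p ?z) * det (trail (psum k (Suc i)) \<xi>)" by (rule f)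
    also have "\<dots> = det (trail p (schur_compl (psum k i) ?z))
        * (det (trail (psum k i) ?z) * det (trail (psum k (Suc i)) \<xi>))"
      by (simp only: det_trail_schur_compl[OF d z le nz p] mult.assoc)
    finally show ?thesis by (simp only: f[OF le])
  qed
  then show ?case using schur_compl_herm[OF d z le nz] zi by metis
qed

lemma det_block_param:
  assumes d: "d \<in> {1, 2}" and \<xi>: "\<xi> \<in> herm_space d (psum k h)"
    and det: "\<And>i. i \<le> h \<Longrightarrow> det (trail (psum k i) \<xi>) \<noteq> 0"
    and i: "1 \<le> i" "i \<le> h"
  shows "det (trail (psum k (i - 1)) \<xi>) = det (snd (block_param k h \<xi> i)) * det (trail (psum k i) \<xi>)"
proof -
  have "snd (block_param k h \<xi> i) = trail (psum k (i - 1)) (zeta k h \<xi> i)"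
    by (simp add: block_param_def split_block_def Let_def trail_def)
  moreover have "psum k (i - 1) \<le> psum k i" by (rule psum_mono) simp
  ultimately show ?thesis using det_trail_zeta[OF d \<xi> det i(2)] by metis
qed

lemma ln_rdet_block_param:
  assumes d: "d \<in> {1, 2}" and \<xi>: "\<xi> \<in> herm_space d (psum k h)"
    and det: "\<And>i. i \<le> h \<Longrightarrow> det (trail (psum k i) \<xi>) \<noteq> 0"
    and i: "1 \<le> i" "i \<le> h"
  shows "rdet (snd (block_param k h \<xi> i)) \<noteq> 0"
    "ln (rdet (snd (block_param k h \<xi> i)))
      = ln (rdet (trail (psum k (i - 1)) \<xi>)) - ln (rdet (trail (psum k i) \<xi>))"
proof -
  let ?x = "det (snd (block_param k h \<xi> i))"
  have real: "det (trail p \<xi>) = complex_of_real (rdet (trail p \<xi>))" for p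
    by (rule det_herm_real[OF d trail_herm[OF d \<xi>]])
  have nz: "rdet (trail (psum k j) \<xi>) \<noteq> 0" if "j \<le> h" for j
    using det[OF that] real[of "psum k j"] by auto
  have "?x = complex_of_real (rdet (trail (psum k (i - 1)) \<xi>) / rdet (trail (psum k i) \<xi>))"
    using det_block_param[OF d \<xi> det i] nz[OF i(2)]
    unfolding real[of "psum k (i - 1)"] real[of "psum k i"] by (simp add: field_simps)
  then have eq: "rdet (snd (block_param k h \<xi> i)) = rdet (trail (psum k (i - 1)) \<xi>) / rdet (trail (psum k i) \<xi>)"
    by (simp add: rdet_def)
  have "i - 1 \<le> h" using i by simp
  then show "rdet (snd (block_param k h \<xi> i)) \<noteq> 0"
    "ln (rdet (snd (block_param k h \<xi> i)))
      = ln (rdet (trail (psum k (i - 1)) \<xi>)) - ln (rdet (trail (psum k i) \<xi>))"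
    using nz[OF i(2)] nz[of "i - 1"] by (simp_all add: eq ln_div)
qed

section \<open>Minors of positive definite matrices\<close>

text \<open>For \<open>d = 1\<close> the real and the imaginary part of a complex kernel vector of a real matrix are again in
the kernel, and one of them is nonzero.  This is required because positive definiteness over \<open>d = 1\<close>
tests real vectors only.\<close>

lemma kernel_vector_over_scalars:
  assumes d: "d \<in> {1, 2}" and T: "T \<in> herm_space d m" and det: "det T = 0"
  obtains v where "v \<in> carrier_vec m" "set\<^sub>v v \<subseteq> scalars d" "v \<noteq> 0\<^sub>v m" "T *\<^sub>v v = 0\<^sub>v m"
proof -
  note Tc = hermD(1)[OF d T]
  obtain v where v: "v \<in> carrier_vec m" "v \<noteq> 0\<^sub>v m" "T *\<^sub>v v = 0\<^sub>v m"
    using det det_0_iff_vec_prod_zero_field[OF Tc] by blast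
  note goal = that
  show thesis
  proof (cases "d = 1")
    case False
    then show thesis using goal[OF v(1) _ v(2,3)] by (simp add: scalars_def)
  next
    case True
    have real: "T $$ (i, j) = complex_of_real (Re (T $$ (i, j)))" if "i < m" "j < m" for i j
    proof -
      have "T $$ (j, i) = T $$ (i, j)"
        using Tc hermD(3)[OF d T True] that by (metis carrier_matD index_transpose_mat(1))
      moreover have "cnj (T $$ (j, i)) = T $$ (i, j)"
        using hermD(1,2)[OF d T] adjoint_index[of i T j] that by auto
      ultimately show ?thesis by (simp add: complex_eq_iff)
    qed
    have sum: "(\<Sum>j<m. T $$ (i, j) * v $ j) = 0" if "i < m" for i
    proof -
      have "(T *\<^sub>v v) $ i = (\<Sum>j<m. T $$ (i, j) * v $ j)"
        using that v(1) Tc by (simp add: scalar_prod_def atLeast0LessThan)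
      then show ?thesis using v(3) that by simp
    qed
    have part: thesis
      if g: "\<And>x y. g (x + y) = g x + g y" "\<And>c x. g (complex_of_real c * x) = c * g x"
        and nz: "vec m (\<lambda>j. complex_of_real (g (v $ j))) \<noteq> 0\<^sub>v m" for g :: "complex \<Rightarrow> real"
    proof (rule goal)
      let ?u = "vec m (\<lambda>j. complex_of_real (g (v $ j)))"
      have g0: "g 0 = 0" using g(1)[of 0 0] by simp
      have gs: "g (sum h J) = (\<Sum>j\<in>J. g (h j))" if "finite J" for h and J :: "nat set"
        using that by (induction J rule: finite_induct) (simp_all add: g0 g(1))
      show "?u \<in> carrier_vec m" by simp
      show "set\<^sub>v ?u \<subseteq> scalars d" by (auto simp: vec_set_def scalars_def True)
      show "?u \<noteq> 0\<^sub>v m" by (rule nz)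
      show "T *\<^sub>v ?u = 0\<^sub>v m"
      proof (rule eq_vecI)
        fix i assume "i < dim_vec (0\<^sub>v m :: complex vec)"
        then have i: "i < m" by simp
        have "(T *\<^sub>v ?u) $ i = (\<Sum>j<m. T $$ (i, j) * complex_of_real (g (v $ j)))"
          using i Tc by (simp add: scalar_prod_def atLeast0LessThan)
        also have "\<dots> = (\<Sum>j<m. complex_of_real (g (T $$ (i, j) * v $ j)))"
        proof (intro sum.cong refl)
          fix j assume "j \<in> {..<m}"
          then have j: "j < m" by simp
          have "g (T $$ (i, j) * v $ j) = Re (T $$ (i, j)) * g (v $ j)"
            by (subst real[OF i j]) (rule g(2))
          then show "T $$ (i, j) * complex_of_real (g (v $ j)) = complex_of_real (g (T $$ (i, j) * v $ j))"
            by (subst real[OF i j]) simp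
        qed
        also have "\<dots> = complex_of_real (g (\<Sum>j<m. T $$ (i, j) * v $ j))"
          by (simp add: gs)
        finally show "(T *\<^sub>v ?u) $ i = 0\<^sub>v m $ i" using sum[OF i] g0 i by simp
      qed (use Tc in simp)
    qed
    show thesis
    proof (cases "vec m (\<lambda>j. complex_of_real (Re (v $ j))) = 0\<^sub>v m")
      case False
      then show thesis using part[of Re] by simp
    next
      case True
      have "vec m (\<lambda>j. complex_of_real (Im (v $ j))) \<noteq> 0\<^sub>v m"
      proof
        assume im: "vec m (\<lambda>j. complex_of_real (Im (v $ j))) = 0\<^sub>v m"
        have "v $ j = 0" if "j < m" for j
          using arg_cong[OF True, of "\<lambda>u. u $ j"] arg_cong[OF im, of "\<lambda>u. u $ j"] that
          by (simp add: complex_eq_iff)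
        then show False using v(1,2) by (metis eq_vecI carrier_vecD index_zero_vec)
      qed
      then show thesis using part[of Im] by simp
    qed
  qed
qed

text \<open>A kernel vector of a trailing block, extended by zeros, is a vector on which the quadratic form
vanishes.\<close>

lemma pd_cone_det_trail:
  assumes d: "d \<in> {1, 2}" and \<xi>: "\<xi> \<in> pd_cone d r" and p: "p \<le> r"
  shows "det (trail p \<xi>) \<noteq> 0"
proof
  assume det: "det (trail p \<xi>) = 0"
  have \<xi>h: "\<xi> \<in> herm_space d r" using \<xi> by (simp add: pd_cone_def)
  note xc = herm_carrier[OF d \<xi>h]
  obtain v where v: "v \<in> carrier_vec (r - p)" "set\<^sub>v v \<subseteq> scalars d" "v \<noteq> 0\<^sub>v (r - p)"
    "trail p \<xi> *\<^sub>v v = 0\<^sub>v (r - p)"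
    using kernel_vector_over_scalars[OF d trail_herm[OF d \<xi>h] det] by blast
  define u where "u = vec r (\<lambda>i. if i < p then 0 else v $ (i - p))"
  have u: "u \<in> carrier_vec r" by (simp add: u_def)
  have "v $ i \<in> scalars d" if "i < r - p" for i
    using v(1,2) that by (auto simp: vec_set_def)
  then have us: "set\<^sub>v u \<subseteq> scalars d" by (auto simp: vec_set_def u_def scalars_def)
  have "u \<noteq> 0\<^sub>v r"
  proof
    assume u0: "u = 0\<^sub>v r"
    have "v $ i = 0" if "i < r - p" for i
      using arg_cong[OF u0, of "\<lambda>w. w $ (i + p)"] that by (simp add: u_def)
    then show False using v(1,3) by (metis eq_vecI carrier_vecD index_zero_vec)
  qed
  then have pos: "Re ((\<xi> *\<^sub>v u) \<bullet>c u) > 0"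
    using \<xi> u us by (simp add: pd_cone_def)
  have low: "(\<xi> *\<^sub>v u) $ (i + p) = 0" if i: "i < r - p" for i
  proof -
    have "(\<xi> *\<^sub>v u) $ (i + p) = (\<Sum>j\<in>{0..<r}. \<xi> $$ (i + p, j) * u $ j)"
      using i xc by (simp add: scalar_prod_def u_def)
    also have "\<dots> = (\<Sum>j\<in>{0 + p..<(r - p) + p}. \<xi> $$ (i + p, j) * u $ j)"
      using p by (intro sum.mono_neutral_right) (auto simp: u_def)
    also have "\<dots> = (\<Sum>j\<in>{0..<r - p}. \<xi> $$ (i + p, j + p) * u $ (j + p))"
      by (rule sum.shift_bounds_nat_ivl)
    also have "\<dots> = (trail p \<xi> *\<^sub>v v) $ i"
      using i v(1) trail_carrier[OF xc, of p]
      by (simp add: scalar_prod_def u_def trail_index[OF xc])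
    finally show ?thesis using v(4) i by simp
  qed
  have "(\<xi> *\<^sub>v u) $ j * cnj (u $ j) = 0" if "j < r" for j
    using low[of "j - p"] that by (cases "j < p") (auto simp: u_def)
  then have "(\<xi> *\<^sub>v u) \<bullet>c u = 0"
    using u unfolding scalar_prod_def by (intro sum.neutral) (simp del: index_mult_mat_vec)
  then show False using pos by simp
qed

section \<open>The eigenvalue\<close>

lemma summation_by_parts:
  fixes s g :: "nat \<Rightarrow> 'a :: comm_ring"
  assumes "s 0 = 0"
  shows "(\<Sum>i = 1..h. (s i - s (i - 1)) * g i) = (\<Sum>i = 1..h. s i * (g i - g (Suc i))) + s h * g (Suc h)"
proof (induction h)
  case 0
  then show ?case using assms by simp
next
  case (Suc h)
  then show ?case by (simp add: algebra_simps)
qed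

text \<open>The inner sum collapses because \<open>min (M a) (M c)\<close> is constant in \<open>c\<close> as long as \<open>c \<le> a\<close> and equals \<open>M c\<close>
afterwards; the second summation by parts then leaves the diagonal only.\<close>

lemma sum_min_by_parts:
  fixes s M :: "nat \<Rightarrow> real"
  assumes s0: "s 0 = 0" and M: "\<And>i. i \<in> {1..h} \<Longrightarrow> M (Suc i) \<le> M i" and Mh: "M (Suc h) = 0"
  shows "(\<Sum>a = 1..h. \<Sum>c = 1..h. (s a - s (a - 1)) * (s c - s (c - 1)) * min (M a) (M c))
    = (\<Sum>i = 1..h. (s i)\<^sup>2 * (M i - M (Suc i)))"
proof -
  have mono: "M j \<le> M i" if "i \<in> {1..Suc h}" "j \<in> {1..Suc h}" "i \<le> j" for i j
    using \<open>i \<le> j\<close> that(1,2)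
  proof (induction j rule: dec_induct)
    case (step j)
    then have "M (Suc j) \<le> M j" by (intro M) auto
    then show ?case using step by auto
  qed simp
  define g where "g = (\<lambda>a. \<Sum>i = 1..h. if a \<le> i then s i * (M i - M (Suc i)) else 0)"
  have inner: "(\<Sum>c = 1..h. (s c - s (c - 1)) * min (M a) (M c)) = g a" if a: "a \<in> {1..h}" for a
  proof -
    have "min (M a) (M (Suc h)) = 0" using mono[of a "Suc h"] a Mh by simp
    then have "(\<Sum>c = 1..h. (s c - s (c - 1)) * min (M a) (M c))
      = (\<Sum>i = 1..h. s i * (min (M a) (M i) - min (M a) (M (Suc i))))"
      using summation_by_parts[where s = s and h = h and g = "\<lambda>c. min (M a) (M c)"] s0 by simp
    also have "\<dots> = g a" unfolding g_def
    proof (intro sum.cong refl)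
      fix i assume i: "i \<in> {1..h}"
      show "s i * (min (M a) (M i) - min (M a) (M (Suc i)))
        = (if a \<le> i then s i * (M i - M (Suc i)) else 0)"
      proof (cases "a \<le> i")
        case True
        then show ?thesis using mono[of a i] mono[of a "Suc i"] a i by (simp add: min_def)
      next
        case False
        then show ?thesis using mono[of i a] mono[of "Suc i" a] a i by (simp add: min_def)
      qed
    qed
    finally show ?thesis .
  qed
  have gd: "g i - g (Suc i) = s i * (M i - M (Suc i))" if i: "i \<in> {1..h}" for i
  proof -
    have "g i - g (Suc i) = (\<Sum>j = 1..h. if i = j then s j * (M j - M (Suc j)) else 0)"
      unfolding g_def sum_subtractf[symmetric] by (intro sum.cong refl) auto
    then show ?thesis using i by simp
  qed
  have gh: "g (Suc h) = 0" unfolding g_def by (rule sum.neutral) auto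
  have "(\<Sum>a = 1..h. \<Sum>c = 1..h. (s a - s (a - 1)) * (s c - s (c - 1)) * min (M a) (M c))
     = (\<Sum>a = 1..h. (s a - s (a - 1)) * g a)"
    by (intro sum.cong refl) (simp add: inner[symmetric] sum_distrib_left mult.assoc)
  also have "\<dots> = (\<Sum>i = 1..h. (s i)\<^sup>2 * (M i - M (Suc i)))"
    using summation_by_parts[where s = s and h = h and g = g] s0 gh gd by (simp add: power2_eq_square mult.assoc)
  finally show ?thesis .
qed

lemma sqrt_powr: "sqrt (x powr a) = x powr (a / 2)"
proof -
  have "x powr a = x powr (a / 2) * x powr (a / 2)" by (simp flip: powr_add)
  then show ?thesis by simp
qed

lemma sqrt_prod: "sqrt (\<Prod>i\<in>A. x i) = (\<Prod>i\<in>A. sqrt (x i))"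
  by (induction A rule: infinite_finite_induct) (simp_all add: real_sqrt_mult)

lemma K_fun_eq:
  "K_fun d r h t \<phi> = (\<Prod>i = 1..h. rdet (snd (\<phi> i)) powr (1 / 2 * (t i + (real r - 1) / 2 * real d + 1)))"
  unfolding K_fun_def prior_def jeffreys_prior_def prod_dividef[symmetric] sqrt_prod
    powr_diff[symmetric] sqrt_powr
  by (intro prod.cong refl arg_cong2[where f = "(powr)"]) (simp add: field_simps)

lemma prod_powr_eq_exp:
  fixes x :: "nat \<Rightarrow> real"
  assumes "\<And>i. i \<in> {1..h} \<Longrightarrow> x i \<noteq> 0"
  shows "(\<Prod>i = 1..h. x i powr s i) = exp (\<Sum>i = 1..h. s i * ln (x i))"
  using assms by (simp add: exp_sum powr_def)

theorem proposition1:
  fixes d r h n :: nat and k :: "nat \<Rightarrow> nat" and t :: "nat \<Rightarrow> real"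
    and b :: "nat \<Rightarrow> complex mat" and K :: "complex mat \<Rightarrow> real" and ev :: real
  assumes "d \<in> {1, 2}" and "r > 0" and "h \<ge> 2"
    and "\<forall>i \<in> {1..h}. k i > 0" and "(\<Sum>i = 1..h. k i) = r"
    and "n = herm_dim d r" and "herm_basis d r b"
  defines "K \<equiv> \<lambda>\<xi>. K_fun d r h t (block_param k h \<xi>)"
    and "ev \<equiv> (\<Sum>i = 1..h.
           1 / 4 * real (k i) * (t i - t_R d k i)\<^sup>2
           - (real d)\<^sup>2 / 16 * real (k i) * (real r - 2 * real (psum k i) + real (k i))\<^sup>2)"
  shows "(\<forall>\<xi> \<in> pd_cone d r. K \<xi> =
            (\<Prod>i = 1..h. rdet (snd (block_param k h \<xi> i))
               powr (1 / 2 * (t i + (real r - 1) / 2 * real d + 1))))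
       \<and> LB_eigenfunction_on (pd_cone d r) fisher_metric n b K ev
       \<and> (\<forall>\<xi> \<in> pd_cone d r. K \<xi> \<noteq> 0 \<and> laplace_beltrami fisher_metric n b K \<xi> / K \<xi> = ev)"
proof -
  note d = assms(1)
  have r: "psum k h = r" using assms(5) by (simp add: psum_def)
  \<comment> \<open>Setting s 0 = 0 removes the boundary term at 0 in the summations by parts; at the other end the trailing block of size 0 has logarithm 0.\<close>
  define s where "s = (\<lambda>i. if i = 0 then 0 else 1 / 2 * (t i + (real r - 1) / 2 * real d + 1))"
  define p where "p = (\<lambda>a. psum k (a - 1))"
  define e where "e = (\<lambda>a. s a - s (a - 1))"
  have s0: "s 0 = 0" by (simp add: s_def)
  have K_prod: "K \<xi> = (\<Prod>i = 1..h. rdet (snd (block_param k h \<xi> i)) powr s i)" for \<xi>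
    unfolding K_def K_fun_eq by (intro prod.cong refl) (simp add: s_def)
  have K_exp: "K \<xi> = exp (\<Sum>a\<in>{1..h}. e a * ln (rdet (trail (p a) \<xi>)))"
    if \<xi>r: "\<xi> \<in> herm_space d r" and minors: "\<And>a. a \<in> {1..h} \<Longrightarrow> det (trail (p a) \<xi>) \<noteq> 0" for \<xi>
  proof -
    have \<xi>: "\<xi> \<in> herm_space d (psum k h)" using \<xi>r by (simp add: r)
    have top: "trail (psum k h) \<xi> \<in> carrier_mat 0 0"
      using trail_carrier[OF herm_carrier[OF d \<xi>], of "psum k h"] by simp
    have nz: "det (trail (psum k i) \<xi>) \<noteq> 0" if "i \<le> h" for i
    proof (cases "i = h")
      case True
      then show ?thesis using top by simp
    next
      case False
      then have "Suc i \<in> {1..h}" using that by simp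
      then have "det (trail (p (Suc i)) \<xi>) \<noteq> 0" by (rule minors)
      then show ?thesis by (simp add: p_def)
    qed
    let ?l = "\<lambda>a. ln (rdet (trail (p a) \<xi>))"
    have "K \<xi> = exp (\<Sum>i = 1..h. s i * ln (rdet (snd (block_param k h \<xi> i))))"
      unfolding K_prod by (rule prod_powr_eq_exp) (use ln_rdet_block_param(1)[OF d \<xi> nz] in auto)
    also have "(\<Sum>i = 1..h. s i * ln (rdet (snd (block_param k h \<xi> i)))) = (\<Sum>i = 1..h. s i * (?l i - ?l (Suc i)))"
      by (intro sum.cong refl) (use ln_rdet_block_param(2)[OF d \<xi> nz] in \<open>auto simp: p_def\<close>)
    also have "\<dots> = (\<Sum>a = 1..h. e a * ?l a)"
    proof -
      have "?l (Suc h) = 0" using top by (simp add: p_def rdet_def)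
      then show ?thesis using summation_by_parts[where s = s and h = h and g = ?l] s0 by (simp add: e_def)
    qed
    finally show ?thesis .
  qed
  have p_le: "p a \<le> r" if "a \<in> {1..h}" for a
    unfolding p_def r[symmetric] using that by (intro psum_mono) auto
  interpret herm_coordinates d r n b
    by unfold_locales (use assms in auto)
  interpret power_function d r n b "{1..h}" p e K
  proof unfold_locales
    show "finite {1..h}" by simp
    show "p a \<le> r" if "a \<in> {1..h}" for a by (rule p_le[OF that])
    show "K \<xi> = exp (\<Sum>a\<in>{1..h}. e a * ln (rdet (trail (p a) \<xi>)))"
      if "\<xi> \<in> herm_space d r" "det \<xi> \<noteq> 0" "\<And>a. a \<in> {1..h} \<Longrightarrow> det (trail (p a) \<xi>) \<noteq> 0" for \<xi>
      by (rule K_exp[OF that(1,3)])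
  qed
  have ev: "eigenvalue = ev"
  proof -
    define M where "M = (\<lambda>a. real r - real (p a))"
    have mM: "m a = M a" if "a \<in> {1..h}" for a using p_le[OF that] by (simp add: M_def of_nat_diff)
    have step: "M i - M (Suc i) = real (k i)" "M (Suc i) = real r - real (psum k i)" if "i \<in> {1..h}" for i
      using that psum_Suc[of k "i - 1"] by (simp_all add: M_def p_def)
    have Mh: "M (Suc h) = 0" by (simp add: M_def p_def r)
    have 1: "(\<Sum>a\<in>{1..h}. \<Sum>c\<in>{1..h}. e a * e c * min (m a) (m c)) = (\<Sum>i = 1..h. (s i)\<^sup>2 * real (k i))"
    proof -
      have "M (Suc i) \<le> M i" if "i \<in> {1..h}" for i using step(1)[OF that] by linarith
      then have "(\<Sum>a\<in>{1..h}. \<Sum>c\<in>{1..h}. e a * e c * min (M a) (M c)) = (\<Sum>i = 1..h. (s i)\<^sup>2 * (M i - M (Suc i)))"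
        unfolding e_def by (intro sum_min_by_parts s0 Mh)
      then show ?thesis by (simp add: mM step(1))
    qed
    have 2: "(\<Sum>a\<in>{1..h}. e a * m a * (real r - m a))
       = (\<Sum>i = 1..h. s i * (M i * (real r - M i) - M (Suc i) * (real r - M (Suc i))))"
      using s0 summation_by_parts[where s = s and h = h and g = "\<lambda>a. M a * (real r - M a)"] Mh
      by (simp add: mM e_def mult.assoc)
    have "(s i)\<^sup>2 * real (k i) + real d / 2 * (s i * (M i * (real r - M i) - M (Suc i) * (real r - M (Suc i))))
      = 1 / 4 * real (k i) * (t i - t_R d k i)\<^sup>2
           - (real d)\<^sup>2 / 16 * real (k i) * (real r - 2 * real (psum k i) + real (k i))\<^sup>2"
      if i: "i \<in> {1..h}" for i
    proof -
      have Mi: "M i = real r - real (psum k i) + real (k i)" using step[OF i] by linarith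
      have si: "s i = 1 / 2 * (t i + (real r - 1) / 2 * real d + 1)" using i by (simp add: s_def)
      \<comment> \<open>Completing the square in s i: the linear coefficient is minus d / 2 times this quantity.\<close>
      define \<rho> where "\<rho> = real r - 2 * real (psum k i) + real (k i)"
      have diff: "M i * (real r - M i) - M (Suc i) * (real r - M (Suc i)) = - (real (k i) * \<rho>)"
        unfolding Mi step(2)[OF i] \<rho>_def by (simp add: algebra_simps)
      have tR: "t i - t_R d k i = 2 * s i - real d / 2 * \<rho>"
        unfolding t_R_def si \<rho>_def by (simp add: field_simps)
      show ?thesis
        unfolding tR diff \<rho>_def[symmetric] by (simp add: power2_eq_square algebra_simps)
    qed
    then show ?thesis
      unfolding eigenvalue_def 1 2 ev_def sum_distrib_left sum.distrib[symmetric]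
      by (intro sum.cong refl) blast
  qed
  have U: "\<xi> \<in> U" if "\<xi> \<in> pd_cone d r" for \<xi>
  proof -
    have "\<xi> \<in> herm_space d r" using that by (simp add: pd_cone_def)
    moreover have "det \<xi> \<noteq> 0" using pd_cone_det_trail[OF d that, of 0] by (simp add: trail_0)
    moreover have "\<forall>a\<in>{1..h}. det (trail (p a) \<xi>) \<noteq> 0" using pd_cone_det_trail[OF d that p_le] by blast
    ultimately show ?thesis unfolding U_def by blast
  qed
  have nonzero: "K \<xi> \<noteq> 0" if "\<xi> \<in> pd_cone d r" for \<xi>
    using f_eq[OF U[OF that]] by simp
  have LB: "laplace_beltrami fisher_metric n b K \<xi> = ev * K \<xi>" if "\<xi> \<in> pd_cone d r" for \<xi>
    using laplace_beltrami_power_function[OF U[OF that]] by (simp only: ev)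
  have "1\<^sub>m r \<in> pd_cone d r"
  proof -
    have "1\<^sub>m r \<in> herm_space d r" by (rule hermI[OF d]) (simp_all add: adjoint_one transpose_one)
    moreover have "Re ((1\<^sub>m r *\<^sub>v v) \<bullet>c v) > 0" if "v \<in> carrier_vec r" "v \<noteq> 0\<^sub>v r" for v :: "complex vec"
      using conjugate_square_greater_0_vec[OF that(1)] that by (simp add: less_complex_def)
    ultimately show ?thesis by (simp add: pd_cone_def)
  qed
  then have "LB_eigenfunction_on (pd_cone d r) fisher_metric n b K ev"
    unfolding LB_eigenfunction_on_def LB_defined_on_def
    using power_function_differentiable U nonzero LB by blast
  then show ?thesis
    using LB nonzero by (simp add: K_def K_fun_eq)
qed

end
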